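(* There exist, for every pair $0<v\le u<\infty$, constants $0<c_{u,v}\le C_{u,v}<\infty$ depending only on $u$ and $v$ such that the following holds. Let $d\in\mathbb N_+$, ${\bf R}=(R_1,\dots,R_d)\in\mathbb R_+^d$ with $u=\max\{R_1,\dots,R_d\}$ and $v=\min\{R_1,\dots,R_d\}$, and let $g({\bf R})=\frac{1}{1/R_1+\cdots+1/R_d}$. Write $a_n:=a_n(I_d: W_2^{\bf R}(\mathbb T^d)\to L_2(\mathbb T^d))$. Then $c_{u,v}\,\phi(n)\le a_n\le C_{u,v}\,\phi(n)$ for all $n\in\mathbb N_+$, where $$\phi(n)=\begin{cases}1, & 1\le n\le d,\\ \Big(\frac{\log(1+\frac{d}{\log n})}{\log n}\Big)^{1/2}, & d\le n\le 3^d,\\ d^{-1/2}n^{-g({\bf R})}, & n\ge 3^d.\end{cases}$$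
   Context: $\log$ denotes the logarithm to base 2. $\mathbb T=[0,2\pi]$ with endpoints identified, $\mathbb T^d$ is equipped with the normalized Lebesgue measure $(2\pi)^{-d}d{\bf x}$, and $\hat f({\bf k})=(2\pi)^{-d}\int_{\mathbb T^d}f({\bf x})e^{-i{\bf k}\cdot{\bf x}}d{\bf x}$, ${\bf k}\in\mathbb Z^d$. For ${\bf R}\in\mathbb R_+^d$, the anisotropic Sobolev space $W_2^{\bf R}(\mathbb T^d)$ is the Hilbert space of all $f\in L_2(\mathbb T^d)$ with finite norm $\|f|W_2^{\bf R}(\mathbb T^d)\|=\big(\sum_{{\bf k}\in\mathbb Z^d}(1+\sum_{j=1}^d|k_j|^{2R_j})|\hat f({\bf k})|^2\big)^{1/2}$ (equivalently $\|f\|_{L_2}^2+\sum_j\|\partial^{R_j}f/\partial x_j^{R_j}\|_{L_2}^2$ with Weyl derivatives). $I_d$ denotes the identity (embedding) operator. For a bounded linear operator $T:X\to Y$ between Banach spaces, the approximation numbers are $a_n(T)=\inf\{\|T-A\|: A:X\to Y \text{ linear}, \operatorname{rank}A<n\}$, $n\in\mathbb N_+$. *)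

theory Defs
  imports "HOL-Probability.Probability"
begin

text \<open>Points of the torus T^d are modelled as x :: nat => real, only the
components j < d matter (PiM over {..<d}).  The normalized measure is the
product of the uniform probability measures on [0, 2 pi].\<close>

definition torus :: "nat \<Rightarrow> (nat \<Rightarrow> real) measure" where
  "torus d = PiM {..<d} (\<lambda>_. uniform_measure lborel {0..2*pi})"

definition L2 :: "nat \<Rightarrow> ((nat \<Rightarrow> real) \<Rightarrow> complex) set" where
  "L2 d = {f. f \<in> borel_measurable (torus d) \<and>
              integrable (torus d) (\<lambda>x. (cmod (f x))\<^sup>2)}"

definition L2_norm :: "nat \<Rightarrow> ((nat \<Rightarrow> real) \<Rightarrow> complex) \<Rightarrow> real" where
  "L2_norm d f = sqrt (\<integral>x. (cmod (f x))\<^sup>2 \<partial>torus d)"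

definition lattice :: "nat \<Rightarrow> (nat \<Rightarrow> int) set" where
  "lattice d = {k. \<forall>j\<ge>d. k j = 0}"

definition fourier_coeff :: "nat \<Rightarrow> ((nat \<Rightarrow> real) \<Rightarrow> complex) \<Rightarrow> (nat \<Rightarrow> int) \<Rightarrow> complex" where
  "fourier_coeff d f k =
     (\<integral>x. f x * exp (- \<i> * complex_of_real (\<Sum>j<d. real_of_int (k j) * x j)) \<partial>torus d)"

definition sob_weight :: "nat \<Rightarrow> (nat \<Rightarrow> real) \<Rightarrow> (nat \<Rightarrow> int) \<Rightarrow> real" where
  "sob_weight d R k = 1 + (\<Sum>j<d. \<bar>real_of_int (k j)\<bar> powr (2 * R j))"

definition sobolev :: "nat \<Rightarrow> (nat \<Rightarrow> real) \<Rightarrow> ((nat \<Rightarrow> real) \<Rightarrow> complex) set" where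
  "sobolev d R = {f \<in> L2 d.
      (\<lambda>k. sob_weight d R k * (cmod (fourier_coeff d f k))\<^sup>2) summable_on lattice d}"

definition sobolev_norm :: "nat \<Rightarrow> (nat \<Rightarrow> real) \<Rightarrow> ((nat \<Rightarrow> real) \<Rightarrow> complex) \<Rightarrow> real" where
  "sobolev_norm d R f =
     sqrt (\<Sum>\<^sub>\<infinity>k\<in>lattice d. sob_weight d R k * (cmod (fourier_coeff d f k))\<^sup>2)"

definition ae_eq :: "nat \<Rightarrow> ((nat \<Rightarrow> real) \<Rightarrow> complex) \<Rightarrow> ((nat \<Rightarrow> real) \<Rightarrow> complex) \<Rightarrow> bool" where
  "ae_eq d f g \<longleftrightarrow> (AE x in torus d. f x = g x)"

text \<open>Bounded linear operators A : W_2^R -> L_2 of rank < n, acting on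
representatives and compatible with almost-everywhere equality
(i.e. well defined on equivalence classes).\<close>
definition admissible ::
  "nat \<Rightarrow> (nat \<Rightarrow> real) \<Rightarrow> nat \<Rightarrow>
   (((nat \<Rightarrow> real) \<Rightarrow> complex) \<Rightarrow> ((nat \<Rightarrow> real) \<Rightarrow> complex)) \<Rightarrow> bool" where
  "admissible d R n A \<longleftrightarrow>
     (\<forall>f\<in>sobolev d R. A f \<in> L2 d) \<and>
     (\<forall>f\<in>sobolev d R. \<forall>g\<in>sobolev d R. \<forall>a b :: complex.
        ae_eq d (A (\<lambda>x. a * f x + b * g x)) (\<lambda>x. a * A f x + b * A g x)) \<and>
     (\<forall>f\<in>sobolev d R. ae_eq d f (\<lambda>_. 0) \<longrightarrow> ae_eq d (A f) (\<lambda>_. 0)) \<and>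
     (\<exists>B. \<forall>f\<in>sobolev d R. L2_norm d (A f) \<le> B * sobolev_norm d R f) \<and>
     (\<exists>G. finite G \<and> card G < n \<and> G \<subseteq> L2 d \<and>
        (\<forall>f\<in>sobolev d R. \<exists>c. ae_eq d (A f) (\<lambda>x. \<Sum>g\<in>G. c g * g x)))"

definition op_dist ::
  "nat \<Rightarrow> (nat \<Rightarrow> real) \<Rightarrow>
   (((nat \<Rightarrow> real) \<Rightarrow> complex) \<Rightarrow> ((nat \<Rightarrow> real) \<Rightarrow> complex)) \<Rightarrow> real" where
  "op_dist d R A = Sup {L2_norm d (\<lambda>x. f x - A f x) | f.
                          f \<in> sobolev d R \<and> sobolev_norm d R f \<le> 1}"

definition approx_num :: "nat \<Rightarrow> (nat \<Rightarrow> real) \<Rightarrow> nat \<Rightarrow> real" where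
  "approx_num d R n = Inf {op_dist d R A | A. admissible d R n A}"

end

theory Submission
  imports Defs
begin

text \<open>
  In the Fourier basis the embedding is diagonal with entries \<open>1 / sqrt (sob_weight d R k)\<close>, so
  the \<open>n\<close>-th approximation number is governed by counting the frequencies \<open>k\<close> with small weight:
  \<open>n\<close> frequencies of weight at most \<open>W\<close> force it above \<open>1 / sqrt W\<close>, since an operator of rank
  below \<open>n\<close> annihilates a combination of them, and fewer than \<open>n\<close> frequencies of weight below
  \<open>W\<close> give the opposite bound by truncating the Fourier series.  The truncation error needs
  Parseval's inequality, obtained on the circle from the density of trigonometric polynomials
  (Stone--Weierstrass and regularity of the measure) and on the torus by Fubini and induction on
  \<open>d\<close>.

  Many frequencies of small weight come from vectors with \<open>s\<close> entries \<open>\<plusminus>1\<close> and from boxes with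
  sides adapted to \<open>R\<close>.  The converse count is Rankin's: with \<open>N(t)\<close> the number of frequencies
  with \<open>\<Sum>j. \<bar>k j\<bar> powr (2 * R j) \<le> t\<close>, one has
  \<open>N(t) \<le> exp (lam * t) * (\<Prod>j. \<Sum>i. exp (- lam * \<bar>i\<bar> powr (2 * R j)))\<close>, with
  \<open>lam = 1 + ln (d / t)\<close> for \<open>t \<le> d\<close> and \<open>lam = d / t\<close> for \<open>t \<ge> d\<close>.  All constants enter as
  \<open>d\<close>-th powers, and are harmless because \<open>t\<close> is read off \<open>N(t)\<close> by a \<open>2g\<close>-th power with
  \<open>2g \<le> 2u / d\<close>.
\<close>

subsection \<open>Counting frequencies of bounded weight\<close>

text \<open>The exponential outgrows every power. For \<open>x > 1\<close> and
  \<open>v * m \<ge> 1\<close>, the \<open>m\<close>-th power of \<open>x powr (2 * R)\<close>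
  dominates \<open>x\<^sup>2\<close>, while \<open>y ^ m \<le> m ^ m * exp y\<close>. The constant
  depends on \<open>v\<close> alone, uniformly in \<open>R\<close>; this is what makes the later
  counts uniform in \<open>R\<close>.\<close>

lemma exp_neg_powr_decay:
  fixes v :: real
  assumes v: "0 < v"
  obtains K :: real where "K \<ge> 1"
    "\<And>R x. \<lbrakk>v \<le> R; 0 \<le> x\<rbrakk> \<Longrightarrow> exp (- (x powr (2 * R))) \<le> 4 * K / (1 + x)\<^sup>2"
proof -
  define m where "m = nat \<lceil>1 / v\<rceil>"
  have m: "m \<ge> 1" and vm: "v * m \<ge> 1"
  proof -
    have "1 / v \<le> m"
      unfolding m_def by linarith
    then show "v * m \<ge> 1"
      using v by (simp add: field_simps)
    then show "m \<ge> 1"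
      by (cases m) auto
  qed
  define K where "K = real m ^ m"
  have K: "K \<ge> 1"
    using m by (simp add: K_def)
  have "exp (- (x powr (2 * R))) \<le> 4 * K / (1 + x)\<^sup>2" if "v \<le> R" "0 \<le> x" for R x
  proof (cases "x \<le> 1")
    case True
    have "(1 + x)\<^sup>2 \<le> 2\<^sup>2"
      using True that by (intro power_mono) auto
    then have "4 * K / (1 + x)\<^sup>2 \<ge> 1"
      using K \<open>0 \<le> x\<close> by (simp add: pos_le_divide_eq)
    moreover have "exp (- (x powr (2 * R))) \<le> 1"
      by simp
    ultimately show ?thesis
      by linarith
  next
    case False
    then have x: "x > 1"
      by simp
    define y where "y = x powr (2 * R)"
    have y: "y > 0"
      using x by (simp add: y_def)
    have "x\<^sup>2 = x powr 2"
      using x by simp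
    also have "\<dots> \<le> x powr (2 * R * m)"
    proof -
      have "v * m \<le> R * m"
        using that by (intro mult_right_mono) auto
      then show ?thesis
        using vm x by (intro powr_mono) auto
    qed
    also have "\<dots> = y ^ m"
      using x by (simp add: y_def powr_powr[symmetric] powr_realpow)
    also have "\<dots> \<le> K * (1 + y / m) ^ m"
    proof -
      have "y ^ m \<le> (m * (1 + y / m)) ^ m"
        using y m by (intro power_mono) (auto simp: field_simps)
      then show ?thesis
        by (simp add: K_def power_mult_distrib)
    qed
    also have "\<dots> \<le> K * exp y"
      using exp_ge_one_plus_x_over_n_power_n[of m y] y m K by (intro mult_left_mono) auto
    finally have 1: "x\<^sup>2 \<le> K * exp y" .
    have "(1 + x)\<^sup>2 \<le> (2 * x)\<^sup>2"
      using x by (intro power_mono) auto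
    also have "\<dots> \<le> 4 * (K * exp y)"
      using 1 by (simp add: power_mult_distrib)
    finally show ?thesis
      using x by (simp add: exp_minus y_def field_simps)
  qed
  with K show ?thesis
    by (rule that)
qed

text \<open>Telescoping: 1/(y+k)^2 is at most 1/(y+k-1) - 1/(y+k). The bound is linear in the
  dilation factor \<open>y\<close>, as for the corresponding integral.\<close>

lemma sum_inverse_square_shift_le:
  fixes y :: real
  assumes "y > 0"
  shows "(\<Sum>k=1..M. 1 / (1 + real k / y)\<^sup>2) \<le> y"
proof -
  have "(\<Sum>k=1..M. 1 / (1 + real k / y)\<^sup>2) \<le> y\<^sup>2 * (1 / y - 1 / (y + M))"
  proof (induction M)
    case (Suc M)
    have "1 / (1 + real (Suc M) / y)\<^sup>2 = y\<^sup>2 * (1 / (y + Suc M)\<^sup>2)"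
      using assms by (simp add: field_simps)
    also have "1 / (y + Suc M)\<^sup>2 \<le> 1 / ((y + M) * (y + Suc M))"
      unfolding power2_eq_square using assms
      by (intro divide_left_mono mult_right_mono mult_pos_pos) auto
    also have "\<dots> = 1 / (y + M) - 1 / (y + Suc M)"
      using assms by (simp add: divide_simps add_pos_nonneg)
    finally have "1 / (1 + real (Suc M) / y)\<^sup>2 \<le> y\<^sup>2 * (1 / (y + M) - 1 / (y + Suc M))"
      using assms by (simp add: mult_left_mono)
    with Suc show ?case
      by (simp add: algebra_simps)
  qed (use assms in simp)
  also have "\<dots> \<le> y\<^sup>2 * (1 / y)"
    using assms by (intro mult_left_mono) auto
  finally show ?thesis
    using assms by (simp add: power2_eq_square)
qed

section \<open>Lattice boxes and sublevel sets of the weight\<close>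

lemma sum_abs_symmetric_interval:
  fixes h :: "real \<Rightarrow> real"
  shows "(\<Sum>k=- int M..int M. h \<bar>real_of_int k\<bar>) = h 0 + 2 * (\<Sum>k=1..M. h (real k))"
proof (induction M)
  case (Suc M)
  have "{- int (Suc M)..int (Suc M)} = insert (- int (Suc M)) (insert (int (Suc M)) {- int M..int M})"
    by auto
  then show ?case
    using Suc by (simp add: algebra_simps abs_if)
qed simp

text \<open>Lattice points are zero from index \<open>d\<close> on, whereas members of the dependent
  product are undefined there. Restriction and extension by zero translate between the two, and the
  product of intervals is easy to count.\<close>

lemma finite_lattice_box:
  "finite {k \<in> lattice d. \<forall>j<d. \<bar>k j\<bar> \<le> int (b j)}"
  and card_lattice_box:
  "card {k \<in> lattice d. \<forall>j<d. \<bar>k j\<bar> \<le> int (b j)} = (\<Prod>j<d. 2 * b j + 1)"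
proof -
  let ?B = "{k \<in> lattice d. \<forall>j<d. \<bar>k j\<bar> \<le> int (b j)}"
  let ?P = "\<Pi>\<^sub>E j\<in>{..<d}. {- int (b j)..int (b j)}"
  have "bij_betw (\<lambda>k. restrict k {..<d}) ?B ?P"
  proof (rule bij_betw_byWitness[where f' = "\<lambda>k j. if j < d then k j else 0"])
    show "\<forall>k\<in>?B. (\<lambda>j. if j < d then restrict k {..<d} j else 0) = k"
      by (auto simp: lattice_def fun_eq_iff)
    show "\<forall>k\<in>?P. restrict (\<lambda>j. if j < d then k j else 0) {..<d} = k"
      by (auto simp: PiE_iff extensional_def fun_eq_iff)
    show "(\<lambda>k. restrict k {..<d}) ` ?B \<subseteq> ?P"
    proof (rule image_subsetI)
      fix k assume "k \<in> ?B"
      then show "restrict k {..<d} \<in> ?P"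
        by (intro restrict_PiE_iff[THEN iffD2]) (simp add: abs_le_iff minus_le_iff)
    qed
    show "(\<lambda>k j. if j < d then k j else 0) ` ?P \<subseteq> ?B"
    proof (rule image_subsetI)
      fix k assume k: "k \<in> ?P"
      have "\<bar>k j\<bar> \<le> int (b j)" if "j < d" for j
        using PiE_mem[OF k, of j] that by (simp add: abs_le_iff minus_le_iff)
      then show "(\<lambda>j. if j < d then k j else 0) \<in> ?B"
        by (simp add: lattice_def)
    qed
  qed
  moreover have "finite ?P"
    by (intro finite_PiE) auto
  moreover have "card ?P = (\<Prod>j<d. 2 * b j + 1)"
    by (simp add: card_PiE nat_add_distrib nat_mult_distrib)
  ultimately show "finite ?B" "card ?B = (\<Prod>j<d. 2 * b j + 1)"
    by (auto simp: bij_betw_finite bij_betw_same_card)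
qed

lemma sob_weight_nonneg_sum: "0 \<le> (\<Sum>j<d. \<bar>real_of_int (k j)\<bar> powr (2 * R j))"
  by (intro sum_nonneg) auto

lemma sob_weight_ge_1: "sob_weight d R k \<ge> 1"
  using sob_weight_nonneg_sum[of k R d] by (simp add: sob_weight_def)

text \<open>Each single summand is at most \<open>\<bar>t\<bar>\<close>, so the entry
  \<open>k j\<close> is at most \<open>\<bar>t\<bar> powr (1 / (2 * R j))\<close> in absolute value.
  The sum of these bounds serves as a common side length for all coordinates.\<close>

lemma sublevel_subset_box:
  fixes t :: real
  assumes R: "\<And>j. j < d \<Longrightarrow> 0 < R j"
  shows "\<exists>M. {k \<in> lattice d. sob_weight d R k \<le> 1 + t}
           \<subseteq> {k \<in> lattice d. \<forall>j<d. \<bar>k j\<bar> \<le> int M}"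
proof -
  define M where "M = nat \<lceil>\<Sum>j<d. \<bar>t\<bar> powr (1 / (2 * R j))\<rceil>"
  have "\<bar>k j\<bar> \<le> int M" if k: "sob_weight d R k \<le> 1 + t" and j: "j < d" for k j
  proof -
    have "\<bar>real_of_int (k j)\<bar> powr (2 * R j) \<le> (\<Sum>j<d. \<bar>real_of_int (k j)\<bar> powr (2 * R j))"
      using j by (intro member_le_sum) auto
    also have "\<dots> \<le> \<bar>t\<bar>"
      using k by (simp add: sob_weight_def)
    finally have "(\<bar>real_of_int (k j)\<bar> powr (2 * R j)) powr (1 / (2 * R j))
        \<le> \<bar>t\<bar> powr (1 / (2 * R j))"
      using R[OF j] by (intro powr_mono2) auto
    then have "\<bar>real_of_int (k j)\<bar> \<le> \<bar>t\<bar> powr (1 / (2 * R j))"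
      using R[OF j] by (simp add: powr_powr)
    also have "\<dots> \<le> (\<Sum>j<d. \<bar>t\<bar> powr (1 / (2 * R j)))"
      using j by (intro member_le_sum) auto
    also have "\<dots> \<le> real M"
      unfolding M_def by linarith
    finally show ?thesis
      by linarith
  qed
  then show ?thesis
    by blast
qed

lemma finite_sublevel:
  fixes t :: real
  assumes "\<And>j. j < d \<Longrightarrow> 0 < R j"
  shows "finite {k \<in> lattice d. sob_weight d R k \<le> 1 + t}"
proof -
  obtain M where "{k \<in> lattice d. sob_weight d R k \<le> 1 + t}
      \<subseteq> {k \<in> lattice d. \<forall>j<d. \<bar>k j\<bar> \<le> int M}"
    using sublevel_subset_box[of d R t] assms by blast
  then show ?thesis
    using finite_lattice_box[of d "\<lambda>_. M"] by (rule finite_subset)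
qed

text \<open>Rankin's trick: each point of the sublevel set contributes at least 1 to the
  sum of \<open>exp (lam * (t - (\<Sum>j<d. \<bar>k j\<bar> powr (2 * R j))))\<close>, which factorizes.\<close>
lemma card_sublevel_le:
  fixes t :: real
  assumes R: "\<And>j. j < d \<Longrightarrow> 0 < R j" and lam: "0 \<le> lam"
    and S: "\<And>j M. j < d \<Longrightarrow>
      1 + 2 * (\<Sum>k=1..M. exp (- lam * real k powr (2 * R j))) \<le> S j"
  shows "real (card {k \<in> lattice d. sob_weight d R k \<le> 1 + t}) \<le> exp (lam * t) * (\<Prod>j<d. S j)"
proof -
  let ?A = "{k \<in> lattice d. sob_weight d R k \<le> 1 + t}"
  \<comment> \<open>The box only makes all sums finite. Its side leaves no trace in the result,
    because \<open>S j\<close> bounds the partial sums for every \<open>M\<close>.\<close>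
  obtain M where M: "?A \<subseteq> {k \<in> lattice d. \<forall>j<d. \<bar>k j\<bar> \<le> int M}"
    using sublevel_subset_box[of d R] R by blast
  let ?P = "\<Pi>\<^sub>E j\<in>{..<d}. {- int M..int M}"
  let ?e = "\<lambda>j (i::int). exp (- lam * \<bar>real_of_int i\<bar> powr (2 * R j))"
  have inj: "inj_on (\<lambda>k. restrict k {..<d}) ?A"
  proof (rule inj_onI)
    fix k l assume kl: "k \<in> ?A" "l \<in> ?A" and eq: "restrict k {..<d} = restrict l {..<d}"
    show "k = l"
    proof
      fix j show "k j = l j"
        using kl fun_cong[OF eq, of j] by (cases "j < d") (auto simp: lattice_def)
    qed
  qed
  have sub: "(\<lambda>k. restrict k {..<d}) ` ?A \<subseteq> ?P"
  proof (rule image_subsetI)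
    fix k assume "k \<in> ?A"
    then have "\<bar>k j\<bar> \<le> int M" if "j < d" for j
      using M that by blast
    then show "restrict k {..<d} \<in> ?P"
      by (intro restrict_PiE_iff[THEN iffD2]) (simp add: abs_le_iff minus_le_iff)
  qed
  have "real (card ?A) = (\<Sum>k\<in>?A. 1)"
    by simp
  also have "\<dots> \<le> (\<Sum>k\<in>?A. exp (lam * t) * (\<Prod>j<d. ?e j (k j)))"
  proof (rule sum_mono)
    fix k assume "k \<in> ?A"
    then have "(\<Sum>j<d. \<bar>real_of_int (k j)\<bar> powr (2 * R j)) \<le> t"
      by (simp add: sob_weight_def)
    then have "lam * (\<Sum>j<d. \<bar>real_of_int (k j)\<bar> powr (2 * R j)) \<le> lam * t"
      using lam by (intro mult_left_mono) auto
    then have "1 \<le> exp (lam * t - lam * (\<Sum>j<d. \<bar>real_of_int (k j)\<bar> powr (2 * R j)))"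
      by simp
    also have "\<dots> = exp (lam * t) * (\<Prod>j<d. ?e j (k j))"
      by (simp add: exp_diff exp_minus sum_distrib_left sum_negf exp_sum
          divide_inverse prod_inversef[unfolded o_def, symmetric])
    finally show "1 \<le> exp (lam * t) * (\<Prod>j<d. ?e j (k j))" .
  qed
  also have "\<dots> = exp (lam * t) * (\<Sum>k\<in>?A. \<Prod>j<d. ?e j (restrict k {..<d} j))"
    by (simp add: sum_distrib_left)
  also have "(\<Sum>k\<in>?A. \<Prod>j<d. ?e j (restrict k {..<d} j))
      = (\<Sum>k\<in>(\<lambda>k. restrict k {..<d}) ` ?A. \<Prod>j<d. ?e j (k j))"
    by (subst sum.reindex[OF inj]) simp
  \<comment> \<open>Passing from the sublevel set to the whole box adds nonnegative terms only, and
    over the box the sum of products is a product of sums.\<close>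
  also have "\<dots> \<le> (\<Sum>k\<in>?P. \<Prod>j<d. ?e j (k j))"
    using sub by (intro sum_mono2) (auto intro!: finite_PiE prod_nonneg)
  also have "\<dots> = (\<Prod>j<d. \<Sum>i=- int M..int M. ?e j i)"
    by (subst prod_sum_PiE) auto
  also have "\<dots> \<le> (\<Prod>j<d. S j)"
  proof (intro prod_mono conjI)
    fix j assume j: "j \<in> {..<d}"
    have "(\<Sum>i=- int M..int M. ?e j i) = 1 + 2 * (\<Sum>k=1..M. exp (- lam * real k powr (2 * R j)))"
      using sum_abs_symmetric_interval[of "\<lambda>x. exp (- lam * x powr (2 * R j))" M] by simp
    also have "\<dots> \<le> S j"
      using S j by blast
    finally show "(\<Sum>i=- int M..int M. ?e j i) \<le> S j" .
  qed (auto intro: sum_nonneg)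
  finally show ?thesis
    by (simp add: mult_left_mono)
qed

text \<open>Two choices of the parameter in Rankin's bound. For \<open>t \<le> d\<close> each
  one-dimensional sum is at most 1 + 8 K t / d, so the product over the coordinates stays below
  exp(8 K t). For \<open>t \<ge> d\<close> the parameter is at most 1, the prefactor is exp(d), and
  each sum has the size of the dilation (t/d)^(1/(2 R_j)).\<close>

lemma card_sublevel_bounds:
  fixes v :: real
  assumes v: "0 < v"
  obtains D :: real where "D \<ge> 9"
    "\<And>d R t::real. \<lbrakk>\<And>j. j < d \<Longrightarrow> v \<le> R j; 0 < t; t \<le> real d\<rbrakk> \<Longrightarrow>
       real (card {k \<in> lattice d. sob_weight d R k \<le> 1 + t}) \<le> exp (t * (D + ln (d / t)))"
    "\<And>d R t::real. \<lbrakk>\<And>j. j < d \<Longrightarrow> v \<le> R j; 0 < t; real d \<le> t; 0 < d\<rbrakk> \<Longrightarrow>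
       real (card {k \<in> lattice d. sob_weight d R k \<le> 1 + t})
         \<le> (exp 1 * D) ^ d * (t / d) powr (\<Sum>j<d. 1 / (2 * R j))"
proof -
  obtain K :: real where K: "K \<ge> 1"
    and dec: "\<And>R x. \<lbrakk>v \<le> R; 0 \<le> x\<rbrakk> \<Longrightarrow> exp (- (x powr (2 * R))) \<le> 4 * K / (1 + x)\<^sup>2"
    using exp_neg_powr_decay[OF v] by blast
  \<comment> \<open>One constant serves both ranges: the summand 1 is the constant part of
    \<open>lam\<close> in the first range and absorbs the term \<open>k = 0\<close> in the second,
    while 8 K comes from the two tails of each sum.\<close>
  define D where "D = 1 + 8 * K"
  have D: "D \<ge> 9"
    using K by (simp add: D_def)
  have sum_le: "(\<Sum>k=1..M. exp (- ((real k / y) powr (2 * R)))) \<le> 4 * K * y"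
    if "v \<le> R" "y > 0" for R y M
  proof -
    have "(\<Sum>k=1..M. exp (- ((real k / y) powr (2 * R)))) \<le> (\<Sum>k=1..M. 4 * K * (1 / (1 + real k / y)\<^sup>2))"
      using dec[OF \<open>v \<le> R\<close>] that by (intro sum_mono) (simp add: divide_inverse)
    also have "\<dots> = 4 * K * (\<Sum>k=1..M. 1 / (1 + real k / y)\<^sup>2)"
      by (simp only: sum_distrib_left)
    also have "\<dots> \<le> 4 * K * y"
      using sum_inverse_square_shift_le[OF \<open>y > 0\<close>] K by (intro mult_left_mono) auto
    finally show ?thesis .
  qed
  show ?thesis
  proof (rule that[OF D])
    fix d R and t :: real
    assume R: "\<And>j. j < d \<Longrightarrow> v \<le> R j" and t: "0 < t" "t \<le> real d"
    define lam where "lam = 1 + ln (d / t)"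
    have lam: "lam \<ge> 1"
      using t by (simp add: lam_def)
    define q where "q = 8 * K * exp (1 - lam)"
    have q: "q = 8 * K * (t / d)" "q \<ge> 0"
      using t K by (auto simp: q_def lam_def exp_minus exp_ln)
    have "1 + 2 * (\<Sum>k=1..M. exp (- lam * real k powr (2 * R j))) \<le> 1 + q" if j: "j < d" for j M
    proof -
      have "(\<Sum>k=1..M. exp (- lam * real k powr (2 * R j)))
          \<le> (\<Sum>k=1..M. exp (1 - lam) * exp (- ((real k / 1) powr (2 * R j))))"
      proof (rule sum_mono)
        fix k assume "k \<in> {1..M}"
        then have "real k powr (2 * R j) \<ge> 1"
          using R[OF j] v by (intro ge_one_powr_ge_zero) auto
        \<comment> \<open>Since \<open>k\<close> is at least 1, the excess \<open>lam - 1\<close> of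
          the exponent can be pulled out of every term as the factor \<open>exp (1 - lam)\<close>,
          which equals t/d.\<close>
        then have "(lam - 1) * 1 \<le> (lam - 1) * real k powr (2 * R j)"
          using lam by (intro mult_left_mono) auto
        then show "exp (- lam * real k powr (2 * R j)) \<le> exp (1 - lam) * exp (- ((real k / 1) powr (2 * R j)))"
          by (simp add: exp_add[symmetric] algebra_simps)
      qed
      also have "\<dots> = exp (1 - lam) * (\<Sum>k=1..M. exp (- ((real k / 1) powr (2 * R j))))"
        by (simp only: sum_distrib_left)
      also have "\<dots> \<le> exp (1 - lam) * (4 * K * 1)"
        using sum_le[OF R[OF j], of 1 M] by (intro mult_left_mono) auto
      finally show ?thesis
        by (simp add: q_def algebra_simps)
    qed
    then have "real (card {k \<in> lattice d. sob_weight d R k \<le> 1 + t}) \<le> exp (lam * t) * (\<Prod>j<d. 1 + q)"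
      using R v lam by (intro card_sublevel_le) (auto intro: less_le_trans)
    also have "(\<Prod>j<d. 1 + q) \<le> exp q ^ d"
      using q(2) exp_ge_add_one_self[of q] by (auto intro!: power_mono)
    also have "exp q ^ d = exp (8 * K * t)"
      using t by (simp add: exp_of_nat_mult[symmetric] q(1))
    also have "exp (lam * t) * exp (8 * K * t) = exp (t * (D + ln (d / t)))"
      by (simp add: exp_add[symmetric] lam_def D_def algebra_simps)
    finally show "real (card {k \<in> lattice d. sob_weight d R k \<le> 1 + t}) \<le> exp (t * (D + ln (d / t)))"
      by simp
  next
    fix d R and t :: real
    assume R: "\<And>j. j < d \<Longrightarrow> v \<le> R j" and t: "0 < t" "real d \<le> t" and d: "0 < d"
    define lam where "lam = d / t"
    have lam: "0 < lam" "lam \<le> 1"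
      using t d by (auto simp: lam_def)
    have "1 + 2 * (\<Sum>k=1..M. exp (- lam * real k powr (2 * R j))) \<le> D * (t / d) powr (1 / (2 * R j))"
      if j: "j < d" for j M
    proof -
      have Rj: "R j > 0"
        using R[OF j] v by simp
      \<comment> \<open>The scale at which the exponent reaches size 1:
        \<open>lam * k powr (2 * R j)\<close> is the undilated power evaluated at
        \<open>k / y\<close>.\<close>
      define y where "y = (t / d) powr (1 / (2 * R j))"
      have y: "y \<ge> 1"
        using t d Rj by (auto simp: y_def intro!: ge_one_powr_ge_zero)
      have "(real k / y) powr (2 * R j) = lam * real k powr (2 * R j)" for k
      proof -
        have "y powr (2 * R j) = t / d"
          using Rj t d by (simp add: y_def powr_powr)
        then show ?thesis
          using y by (simp add: powr_divide lam_def)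
      qed
      then have "(\<Sum>k=1..M. exp (- lam * real k powr (2 * R j))) \<le> 4 * K * y"
        using sum_le[OF R[OF j], of y M] y by simp
      then have "1 + 2 * (\<Sum>k=1..M. exp (- lam * real k powr (2 * R j))) \<le> 1 * y + 8 * K * y"
        using y by simp
      then show ?thesis
        by (simp add: D_def y_def algebra_simps)
    qed
    then have "real (card {k \<in> lattice d. sob_weight d R k \<le> 1 + t})
        \<le> exp (lam * t) * (\<Prod>j<d. D * (t / d) powr (1 / (2 * R j)))"
      using R v lam by (intro card_sublevel_le) (auto intro: less_le_trans)
    also have "\<dots> = (exp 1 * D) ^ d * (t / d) powr (\<Sum>j<d. 1 / (2 * R j))"
      using t d by (simp add: prod.distrib powr_sum lam_def power_mult_distrib exp_of_nat_mult[symmetric])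
    finally show "real (card {k \<in> lattice d. sob_weight d R k \<le> 1 + t})
         \<le> (exp 1 * D) ^ d * (t / d) powr (\<Sum>j<d. 1 / (2 * R j))" .
  qed
qed

subsection \<open>Square-mean density of trigonometric polynomials on the circle\<close>

abbreviation circle :: "real measure" where
  "circle \<equiv> uniform_measure lborel {0..2*pi}"

lemma prob_space_circle: "prob_space circle"
  by (rule prob_space_uniform_measure) auto

text \<open>The endpoints are a null set and the only distinct points of the interval with the same
  \<open>cis\<close>. Discarding them allows sets to be separated by continuous functions of
  \<open>cis x\<close>.\<close>

lemma AE_circle_interior: "AE x in circle. x \<in> {0<..<2*pi}"
proof -
  have "AE x in lborel. x \<noteq> (0::real)" "AE x in lborel. x \<noteq> 2*pi"
    by (rule AE_lborel_singleton)+
  then have "AE x in lborel. x \<in> {0..2*pi} \<longrightarrow> x \<in> {0<..<2*pi}"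
    by eventually_elim auto
  then show ?thesis
    by (subst AE_uniform_measure) auto
qed

text \<open>For \<open>m \<noteq> 0\<close> the antiderivative \<open>?F\<close> takes the same
  value at both endpoints.\<close>

lemma integral_circle_cis:
  "(\<integral>x. cis (real_of_int m * x) \<partial>circle) = (if m = 0 then 1 else 0)"
proof (cases "m = 0")
  case True
  interpret prob_space circle
    by (rule prob_space_circle)
  show ?thesis
    using True by (simp add: prob_space)
next
  case False
  let ?F = "\<lambda>x. cis (real_of_int m * x) / (\<i> * of_int m)"
  have "(\<integral>x. cis (real_of_int m * x) \<partial>circle)
      = (\<integral>x. (indicator {0..2*pi} x / (2*pi)) *\<^sub>R cis (real_of_int m * x) \<partial>lborel)"
  proof -
    have "circle = density lborel (\<lambda>x. ennreal (indicator {0..2*pi} x / (2*pi)))"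
      unfolding uniform_measure_def
      by (intro density_cong) (auto simp: indicator_def divide_ennreal[symmetric] ennreal_1[symmetric] simp del: ennreal_1)
    then show ?thesis
      by (simp add: integral_density cis_conv_exp)
  qed
  also have "\<dots> = (\<integral>x. (1 / (2*pi)) *\<^sub>R (indicator {0..2*pi} x *\<^sub>R cis (real_of_int m * x)) \<partial>lborel)"
    by simp
  also have "\<dots> = (1 / (2*pi)) *\<^sub>R (\<integral>x. indicator {0..2*pi} x *\<^sub>R cis (real_of_int m * x) \<partial>lborel)"
    by (rule integral_scaleR_right)
  also have "(\<integral>x. indicator {0..2*pi} x *\<^sub>R cis (real_of_int m * x) \<partial>lborel) = ?F (2*pi) - ?F 0"
  proof (rule integral_FTC_atLeastAtMost)
    fix x :: real
    show "(?F has_vector_derivative cis (real_of_int m * x)) (at x within {0..2*pi})"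
      unfolding cis_conv_exp using False
      by (auto intro!: derivative_eq_intros has_vector_derivative_real_field simp: field_simps)
  qed (auto intro!: continuous_intros)
  also have "cis (real_of_int m * (2*pi)) = 1"
    by (metis cis_multiple_2pi Ints_of_int mult.commute)
  finally show ?thesis
    using False by simp
qed

section \<open>Trigonometric polynomials and their square-mean closure\<close>

definition trig_sum :: "int set \<Rightarrow> (int \<Rightarrow> complex) \<Rightarrow> real \<Rightarrow> complex" where
  "trig_sum F c x = (\<Sum>m\<in>F. c m * cis (real_of_int m * x))"

lemma trig_sum_measurable [measurable]: "trig_sum F c \<in> borel_measurable borel"
  unfolding trig_sum_def[abs_def] cis_conv_exp by measurable

text \<open>Collects the coefficients that share a frequency, since \<open>m\<close> may fail to be
  injective. Sums and products of trigonometric polynomials are brought back to standard form this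
  way.\<close>

lemma reindex_trig_sum:
  fixes a :: "'a \<Rightarrow> complex"
  assumes "finite A"
  obtains c where "\<And>x. (\<Sum>i\<in>A. a i * cis (real_of_int (m i) * x)) = trig_sum (m ` A) c x"
proof
  fix x
  show "(\<Sum>i\<in>A. a i * cis (real_of_int (m i) * x)) = trig_sum (m ` A) (\<lambda>n. \<Sum>i | i \<in> A \<and> m i = n. a i) x"
    unfolding trig_sum_def sum_distrib_right
    by (subst sum.image_gen[OF assms, of _ m]) (auto intro!: sum.cong)
qed

lemma trig_sum_add_ex:
  assumes "finite F" "finite G"
  obtains H e where "finite H" "\<And>x. trig_sum F c x + trig_sum G b x = trig_sum H e x"
proof -
  obtain e where "\<And>x. (\<Sum>i\<in>F <+> G. case_sum c b i * cis (real_of_int (case_sum id id i) * x))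
      = trig_sum (case_sum id id ` (F <+> G)) e x"
    using reindex_trig_sum[of "F <+> G" "case_sum c b" "case_sum id id"] assms by auto
  then show ?thesis
    using assms that[of "case_sum id id ` (F <+> G)" e] by (simp add: sum.Plus trig_sum_def)
qed

lemma trig_sum_mult_ex:
  assumes "finite F" "finite G"
  obtains H e where "finite H" "\<And>x. trig_sum F c x * trig_sum G b x = trig_sum H e x"
proof -
  obtain e where e: "\<And>x. (\<Sum>i\<in>F \<times> G. (c (fst i) * b (snd i)) * cis (real_of_int (fst i + snd i) * x))
      = trig_sum ((\<lambda>i. fst i + snd i) ` (F \<times> G)) e x"
    using reindex_trig_sum[of "F \<times> G" "\<lambda>i. c (fst i) * b (snd i)" "\<lambda>i. fst i + snd i"] assms by auto
  have "trig_sum F c x * trig_sum G b x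
      = (\<Sum>i\<in>F \<times> G. (c (fst i) * b (snd i)) * cis (real_of_int (fst i + snd i) * x))" for x
    unfolding trig_sum_def sum_product sum.cartesian_product
    by (intro sum.cong) (auto simp: cis_mult algebra_simps)
  then show ?thesis
    using assms e that[of "(\<lambda>i. fst i + snd i) ` (F \<times> G)" e] by simp
qed

text \<open>A real-linear functional on the plane is, along the unit circle, a combination of cosine
  and sine. The other cases of the induction are closure under constants, sums and products.\<close>

lemma real_polynomial_function_cis:
  assumes "real_polynomial_function (g :: complex \<Rightarrow> real)"
  shows "\<exists>F c. finite F \<and> (\<forall>x. complex_of_real (g (cis x)) = trig_sum F c x)"
  using assms
proof induction
  case (linear f)
  interpret bounded_linear f
    by fact
  have "f (cis x) = cos x * f 1 + sin x * f \<i>" for x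
  proof -
    have "cis x = cos x *\<^sub>R 1 + sin x *\<^sub>R \<i>"
      by (simp add: complex_eq_iff)
    then show ?thesis
      by (simp add: add scaleR)
  qed
  \<comment> \<open>Euler's formulas rewrite a cos x + b sin x with the coefficients (a - i b)/2 at
    frequency 1 and (a + i b)/2 at frequency -1.\<close>
  moreover define c where "c m = (if m = (1::int) then (f 1 - \<i> * f \<i>) / 2 else (f 1 + \<i> * f \<i>) / 2)" for m
  ultimately have "complex_of_real (f (cis x)) = trig_sum {1, -1} c x" for x
    by (simp add: trig_sum_def complex_eq_iff field_simps)
  then show ?case
    by (intro exI[of _ "{1, -1}"] exI[of _ c]) simp
next
  case (const a)
  have "complex_of_real a = trig_sum {0} (\<lambda>_. of_real a) x" for x
    by (simp add: trig_sum_def)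
  then show ?case
    by (intro exI[of _ "{0}"] exI[of _ "\<lambda>_. of_real a"]) simp
next
  case (add f g)
  then obtain F G c b where "finite F" "finite G" "\<And>x. complex_of_real (f (cis x)) = trig_sum F c x"
    "\<And>x. complex_of_real (g (cis x)) = trig_sum G b x"
    by blast
  then show ?case
    using trig_sum_add_ex[of F G c b] by (metis of_real_add)
next
  case (mult f g)
  then obtain F G c b where "finite F" "finite G" "\<And>x. complex_of_real (f (cis x)) = trig_sum F c x"
    "\<And>x. complex_of_real (g (cis x)) = trig_sum G b x"
    by blast
  then show ?case
    using trig_sum_mult_ex[of F G c b] by (metis of_real_mult)
qed

text \<open>The squared L2 distance, taken in \<open>ennreal\<close> so that it makes sense before
  integrability is known.\<close>

definition sqdist :: "(real \<Rightarrow> complex) \<Rightarrow> (real \<Rightarrow> complex) \<Rightarrow> ennreal" where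
  "sqdist f g = (\<integral>\<^sup>+x. ennreal ((cmod (f x - g x))\<^sup>2) \<partial>circle)"

definition trig_approx :: "(real \<Rightarrow> complex) \<Rightarrow> bool" where
  "trig_approx f \<longleftrightarrow> (\<forall>e>0. \<exists>F c. finite F \<and> sqdist f (trig_sum F c) \<le> ennreal e)"

text \<open>Replaces the triangle inequality at the level of squares. The factor 2 does no harm
  where only smallness or finiteness is at stake.\<close>

lemma cmod_diff_sq_le: "(cmod (a - b))\<^sup>2 \<le> 2 * (cmod (a - c))\<^sup>2 + 2 * (cmod (c - b))\<^sup>2"
proof -
  have "cmod (a - b) \<le> cmod (a - c) + cmod (c - b)"
    by (metis diff_add_cancel add_diff_eq norm_triangle_ineq)
  then have "(cmod (a - b))\<^sup>2 \<le> (cmod (a - c) + cmod (c - b))\<^sup>2"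
    by (intro power_mono) auto
  also have "\<dots> \<le> 2 * (cmod (a - c))\<^sup>2 + 2 * (cmod (c - b))\<^sup>2"
    using zero_le_power2[of "cmod (a - c) - cmod (c - b)"]
    by (simp add: power2_eq_square algebra_simps)
  finally show ?thesis .
qed

lemma sqdist_triangle:
  assumes [measurable]: "f \<in> borel_measurable borel" "g \<in> borel_measurable borel" "h \<in> borel_measurable borel"
  shows "sqdist f h \<le> 2 * sqdist f g + 2 * sqdist g h"
proof -
  have "sqdist f h \<le> (\<integral>\<^sup>+x. 2 * ennreal ((cmod (f x - g x))\<^sup>2) + 2 * ennreal ((cmod (g x - h x))\<^sup>2) \<partial>circle)"
    unfolding sqdist_def
  proof (intro nn_integral_mono)
    fix x
    have "ennreal ((cmod (f x - h x))\<^sup>2) \<le> ennreal (2 * (cmod (f x - g x))\<^sup>2 + 2 * (cmod (g x - h x))\<^sup>2)"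
      by (intro ennreal_leI cmod_diff_sq_le)
    then show "ennreal ((cmod (f x - h x))\<^sup>2)
        \<le> 2 * ennreal ((cmod (f x - g x))\<^sup>2) + 2 * ennreal ((cmod (g x - h x))\<^sup>2)"
      by (simp add: ennreal_mult')
  qed
  also have "\<dots> = 2 * sqdist f g + 2 * sqdist g h"
    by (simp add: sqdist_def nn_integral_add nn_integral_cmult)
  finally show ?thesis .
qed

lemma trig_approx_limit:
  assumes [measurable]: "f \<in> borel_measurable borel"
    and g: "\<And>e. 0 < e \<Longrightarrow> \<exists>g. g \<in> borel_measurable borel \<and> trig_approx g \<and> sqdist f g \<le> ennreal e"
  shows "trig_approx f"
  unfolding trig_approx_def
proof (intro allI impI)
  fix e :: real assume e: "0 < e"
  \<comment> \<open>Each of the two errors is at most \<open>e/4\<close>, because the triangle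
    inequality for squares doubles both.\<close>
  then obtain g where [measurable]: "g \<in> borel_measurable borel" and g: "trig_approx g" "sqdist f g \<le> ennreal (e/4)"
    using g[of "e/4"] by auto
  obtain F c where F: "finite F" "sqdist g (trig_sum F c) \<le> ennreal (e/4)"
    using g(1) e unfolding trig_approx_def by (meson divide_pos_pos zero_less_numeral)
  have "sqdist f (trig_sum F c) \<le> 2 * sqdist f g + 2 * sqdist g (trig_sum F c)"
    by (rule sqdist_triangle) measurable
  also have "\<dots> \<le> 2 * ennreal (e/4) + 2 * ennreal (e/4)"
    using g(2) F(2) by (intro add_mono mult_left_mono) auto
  also have "\<dots> = ennreal e"
    using e by (simp add: ennreal_plus[symmetric] ennreal_numeral[symmetric] ennreal_mult[symmetric] del: ennreal_plus ennreal_numeral)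
  finally show "\<exists>F c. finite F \<and> sqdist f (trig_sum F c) \<le> ennreal e"
    using F(1) by blast
qed

lemma trig_approx_add:
  assumes [measurable]: "f \<in> borel_measurable borel" "g \<in> borel_measurable borel"
    and f: "trig_approx f" and g: "trig_approx g"
  shows "trig_approx (\<lambda>x. f x + g x)"
  unfolding trig_approx_def
proof (intro allI impI)
  fix e :: real assume e: "0 < e"
  obtain F c where F: "finite F" "sqdist f (trig_sum F c) \<le> ennreal (e/4)"
    using f e unfolding trig_approx_def by (meson divide_pos_pos zero_less_numeral)
  obtain G b where G: "finite G" "sqdist g (trig_sum G b) \<le> ennreal (e/4)"
    using g e unfolding trig_approx_def by (meson divide_pos_pos zero_less_numeral)
  obtain H a where H: "finite H" "\<And>x. trig_sum F c x + trig_sum G b x = trig_sum H a x"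
    using trig_sum_add_ex[OF F(1) G(1)] by metis
  have "sqdist (\<lambda>x. f x + g x) (trig_sum H a)
      \<le> 2 * sqdist (\<lambda>x. f x + g x) (\<lambda>x. trig_sum F c x + g x) + 2 * sqdist (\<lambda>x. trig_sum F c x + g x) (trig_sum H a)"
    by (rule sqdist_triangle) measurable
  also have "sqdist (\<lambda>x. f x + g x) (\<lambda>x. trig_sum F c x + g x) = sqdist f (trig_sum F c)"
    by (simp add: sqdist_def)
  also have "sqdist (\<lambda>x. trig_sum F c x + g x) (trig_sum H a) = sqdist g (trig_sum G b)"
    by (simp add: sqdist_def H(2)[symmetric])
  also have "2 * sqdist f (trig_sum F c) + 2 * sqdist g (trig_sum G b) \<le> 2 * ennreal (e/4) + 2 * ennreal (e/4)"
    using F(2) G(2) by (intro add_mono mult_left_mono) auto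
  also have "\<dots> = ennreal e"
    using e by (simp add: ennreal_plus[symmetric] ennreal_numeral[symmetric] ennreal_mult[symmetric] del: ennreal_plus ennreal_numeral)
  finally show "\<exists>F c. finite F \<and> sqdist (\<lambda>x. f x + g x) (trig_sum F c) \<le> ennreal e"
    using H(1) by blast
qed

lemma trig_approx_cmult:
  assumes [measurable]: "f \<in> borel_measurable borel" and f: "trig_approx f"
  shows "trig_approx (\<lambda>x. a * f x)"
  unfolding trig_approx_def
proof (intro allI impI)
  fix e :: real assume e: "0 < e"
  define \<epsilon> where "\<epsilon> = e / ((cmod a)\<^sup>2 + 1)"
  have pos: "(cmod a)\<^sup>2 + 1 > 0"
    by (simp add: add_nonneg_pos)
  have \<epsilon>: "\<epsilon> > 0" "(cmod a)\<^sup>2 * \<epsilon> \<le> e"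
    using e pos by (auto simp: \<epsilon>_def field_simps)
  obtain F c where F: "finite F" "sqdist f (trig_sum F c) \<le> ennreal \<epsilon>"
    using f \<epsilon>(1) unfolding trig_approx_def by blast
  have "trig_sum F (\<lambda>m. a * c m) x = a * trig_sum F c x" for x
    by (simp add: trig_sum_def sum_distrib_left mult.assoc)
  then have "sqdist (\<lambda>x. a * f x) (trig_sum F (\<lambda>m. a * c m))
      = (\<integral>\<^sup>+x. ennreal ((cmod a)\<^sup>2) * ennreal ((cmod (f x - trig_sum F c x))\<^sup>2) \<partial>circle)"
    unfolding sqdist_def
    by (intro nn_integral_cong)
       (simp add: right_diff_distrib[symmetric] norm_mult power_mult_distrib ennreal_mult)
  also have "\<dots> = ennreal ((cmod a)\<^sup>2) * sqdist f (trig_sum F c)"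
    by (simp add: sqdist_def nn_integral_cmult)
  also have "\<dots> \<le> ennreal ((cmod a)\<^sup>2) * ennreal \<epsilon>"
    by (intro mult_left_mono F) auto
  also have "\<dots> \<le> ennreal e"
    using \<epsilon> by (simp add: ennreal_mult[symmetric] ennreal_leI)
  finally show "\<exists>F c. finite F \<and> sqdist (\<lambda>x. a * f x) (trig_sum F c) \<le> ennreal e"
    using F(1) by blast
qed

lemma trig_approx_zero: "trig_approx (\<lambda>_. 0)"
proof -
  have "sqdist (\<lambda>_. 0) (trig_sum {} (\<lambda>_. 0)) = 0"
    by (simp add: sqdist_def trig_sum_def)
  then show ?thesis
    unfolding trig_approx_def by (metis finite.emptyI zero_le)
qed

lemma trig_approx_sum:
  assumes "finite I" "\<And>i. i \<in> I \<Longrightarrow> f i \<in> borel_measurable borel" "\<And>i. i \<in> I \<Longrightarrow> trig_approx (f i)"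
  shows "trig_approx (\<lambda>x. \<Sum>i\<in>I. f i x)"
  using assms
  by (induction I) (auto simp: trig_approx_zero intro!: trig_approx_add borel_measurable_sum)

text \<open>Stone--Weierstrass on the compact unit circle. A uniform error below
  \<open>sqrt e\<close> gives squared error at most \<open>e\<close> everywhere, and the measure has
  total mass 1.\<close>

lemma trig_approx_continuous:
  assumes "continuous_on UNIV (\<phi> :: complex \<Rightarrow> real)"
  shows "trig_approx (\<lambda>x. complex_of_real (\<phi> (cis x)))"
  unfolding trig_approx_def
proof (intro allI impI)
  fix e :: real assume e: "0 < e"
  interpret prob_space circle
    by (rule prob_space_circle)
  have "continuous_on (sphere 0 1) \<phi>"
    using assms continuous_on_subset by blast
  then obtain g where g: "real_polynomial_function g" "\<And>x. x \<in> sphere 0 1 \<Longrightarrow> \<bar>\<phi> x - g x\<bar> < sqrt e"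
    using Stone_Weierstrass_real_polynomial_function[of "sphere (0::complex) 1" \<phi> "sqrt e"] e
    by (metis compact_sphere real_sqrt_gt_zero)
  obtain F c where F: "finite F" "\<And>x. complex_of_real (g (cis x)) = trig_sum F c x"
    using real_polynomial_function_cis[OF g(1)] by blast
  have "sqdist (\<lambda>x. complex_of_real (\<phi> (cis x))) (trig_sum F c) \<le> (\<integral>\<^sup>+x. ennreal e \<partial>circle)"
    unfolding sqdist_def
  proof (intro nn_integral_mono ennreal_leI)
    fix x
    have "cmod (complex_of_real (\<phi> (cis x)) - trig_sum F c x) = \<bar>\<phi> (cis x) - g (cis x)\<bar>"
      by (simp add: F(2)[symmetric] of_real_diff[symmetric] del: of_real_diff)
    also have "\<dots> \<le> sqrt e"
      using g(2)[of "cis x"] by simp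
    finally have "(cmod (complex_of_real (\<phi> (cis x)) - trig_sum F c x))\<^sup>2 \<le> (sqrt e)\<^sup>2"
      by (intro power_mono) auto
    then show "(cmod (complex_of_real (\<phi> (cis x)) - trig_sum F c x))\<^sup>2 \<le> e"
      using e by simp
  qed
  also have "\<dots> = ennreal e"
    by (simp add: emeasure_space_1[simplified])
  finally show "\<exists>F c. finite F \<and> sqdist (\<lambda>x. complex_of_real (\<phi> (cis x))) (trig_sum F c) \<le> ennreal e"
    using F(1) by blast
qed

lemma cis_eq_interior:
  assumes "cis x = cis y" "x \<in> {0<..<2*pi}" "y \<in> {0..2*pi}"
  shows "x = y"
proof -
  have "cis (x - y) = 1"
    using assms(1) by (simp add: cis_divide[symmetric])
  then have "cos (x - y) = 1"
    by (simp add: complex_eq_iff)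
  then obtain n :: int where n: "x - y = n * 2 * pi"
    by (auto simp: cos_one_2pi_int)
  have "\<bar>x - y\<bar> < 2 * pi"
    using assms by auto
  then have "\<bar>real_of_int n\<bar> * (2 * pi) < 1 * (2 * pi)"
    by (simp add: n abs_mult)
  then have "\<bar>real_of_int n\<bar> < 1"
    by (subst (asm) mult_less_cancel_right) auto
  then have "n = 0"
    by linarith
  then show ?thesis
    using n by simp
qed

text \<open>Regularity encloses the set between a compact and an open one whose difference has
  measure at most \<open>e\<close>. Urysohn's lemma, applied in the plane to the images under
  \<open>cis\<close>, gives a continuous function that differs from the indicator only on this
  difference, up to a null set, and there by at most 1.\<close>

lemma trig_approx_indicator:
  assumes B [measurable]: "B \<in> sets borel"
  shows "trig_approx (indicator B)"
proof (rule trig_approx_limit)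
  fix e :: real assume e: "0 < e"
  interpret prob_space circle
    by (rule prob_space_circle)
  let ?I = "{0<..<2*pi}"
  \<comment> \<open>Dropping the endpoints changes the set by a null set and makes
    \<open>cis\<close> injective on it.\<close>
  define B' where "B' = B \<inter> ?I"
  have B' [measurable]: "B' \<in> sets borel"
    by (simp add: B'_def)
  note emeasure_uniform_measure [simp del]
  have fin: "emeasure circle (space circle) \<noteq> \<infinity>" and fin': "emeasure circle B' \<noteq> \<infinity>"
    using emeasure_finite by auto
  have sets: "sets circle = sets borel"
    by simp
  have e2: "0 < e/2"
    using e by simp
  have "\<exists>K\<in>{K. K \<subseteq> B' \<and> compact K}. emeasure circle B' < emeasure circle K + ennreal (e/2)"
    by (rule SUP_approx_ennreal[OF e2 _ inner_regular[OF sets fin B'] fin'])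
       (use compact_empty in blast)
  then obtain K where K: "K \<subseteq> B'" "compact K" "emeasure circle B' < emeasure circle K + ennreal (e/2)"
    by (elim bexE CollectE conjE)
  have "\<exists>G\<in>{G. B' \<subseteq> G \<and> open G}. emeasure circle G < emeasure circle B' + ennreal (e/2)"
    by (rule INF_approx_ennreal[OF e2 outer_regular[OF sets fin B'] fin'])
  then obtain G where G: "B' \<subseteq> G" "open G" "emeasure circle G < emeasure circle B' + ennreal (e/2)"
    by (elim bexE CollectE conjE)
  \<comment> \<open>Now both endpoints lie outside \<open>G'\<close>, and a point of
    \<open>K\<close> shares its \<open>cis\<close> with no point of \<open>[0, 2 pi]\<close> outside
    \<open>G'\<close>; hence the closed images \<open>S\<close> and \<open>T\<close> are
    disjoint.\<close>
  define G' where "G' = G \<inter> ?I"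
  have G': "B' \<subseteq> G'" "open G'" "emeasure circle G' \<le> emeasure circle G"
    using G by (auto simp: G'_def B'_def intro!: emeasure_mono)
  have [measurable]: "K \<in> sets borel" "G' \<in> sets borel"
    using K G' by (auto simp: compact_imp_closed)
  define S where "S = cis ` K"
  define T where "T = cis ` ({0..2*pi} - G')"
  have "continuous_on UNIV cis"
    by (intro continuous_intros)
  then have "compact S" "compact T"
    unfolding S_def T_def using K G'
    by (auto intro!: compact_continuous_image compact_diff intro: continuous_on_subset)
  then have "closed S" "closed T"
    by (auto simp: compact_imp_closed)
  moreover have "S \<inter> T = {}"
  proof (rule ccontr)
    assume "S \<inter> T \<noteq> {}"
    then obtain x y where "x \<in> K" "y \<in> {0..2*pi} - G'" "cis x = cis y"
      unfolding S_def T_def by blast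
    moreover from this have "x \<in> ?I"
      using K by (auto simp: B'_def)
    ultimately show False
      using cis_eq_interior[of x y] K G' by auto
  qed
  ultimately obtain \<phi> :: "complex \<Rightarrow> real" where \<phi>: "continuous_on UNIV \<phi>"
    "\<And>z. \<phi> z \<in> closed_segment 1 0" "\<And>z. z \<in> S \<Longrightarrow> \<phi> z = 1" "\<And>z. z \<in> T \<Longrightarrow> \<phi> z = 0"
    using Urysohn[of S T "1::real" 0] by metis
  let ?g = "\<lambda>x. complex_of_real (\<phi> (cis x))"
  have "sqdist (indicator B) ?g \<le> (\<integral>\<^sup>+x. indicator (G' - K) x \<partial>circle)"
    unfolding sqdist_def
  proof (rule nn_integral_mono_AE)
    show "AE x in circle. ennreal ((cmod (indicator B x - ?g x))\<^sup>2) \<le> indicator (G' - K) x"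
      using AE_circle_interior
    proof eventually_elim
      case (elim x)
      consider "x \<in> K" | "x \<in> G' - K" | "x \<notin> G'"
        using K G' by auto
      then show ?case
      proof cases
        case 1
        then have "x \<in> B" "\<phi> (cis x) = 1"
          using K \<phi>(3) by (auto simp: B'_def S_def)
        then show ?thesis
          by simp
      next
        case 2
        have "0 \<le> \<phi> (cis x)" "\<phi> (cis x) \<le> 1"
          using \<phi>(2)[of "cis x"] by (auto simp: closed_segment_eq_real_ivl)
        moreover have "indicator B x - ?g x = complex_of_real (indicator B x - \<phi> (cis x))"
          by (simp add: indicator_def)
        ultimately have "cmod (indicator B x - ?g x) \<le> 1"
          by (simp only: norm_of_real) (auto simp: indicator_def)
        then have "(cmod (indicator B x - ?g x))\<^sup>2 \<le> 1"
          by (intro power_le_one) auto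
        then show ?thesis
          using 2 by (simp add: ennreal_le_1)
      next
        case 3
        then have "x \<notin> B" "\<phi> (cis x) = 0"
          using G' \<phi>(4) elim by (auto simp: B'_def T_def)
        then show ?thesis
          by simp
      qed
    qed
  qed
  also have "\<dots> = emeasure circle (G' - K)"
    by simp
  also have "\<dots> = emeasure circle G' - emeasure circle K"
    using K G' by (intro emeasure_Diff) (auto simp del: emeasure_uniform_measure)
  also have "\<dots> \<le> ennreal e"
  proof -
    have "emeasure circle G' \<le> emeasure circle B' + ennreal (e/2)"
      using G' G by auto
    also have "\<dots> \<le> emeasure circle K + ennreal (e/2) + ennreal (e/2)"
      using K by (intro add_mono) auto
    also have "\<dots> = emeasure circle K + ennreal e"
      using e by (simp add: add.assoc ennreal_plus[symmetric] del: ennreal_plus emeasure_uniform_measure)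
    finally show ?thesis
      by (simp add: ennreal_minus_le_iff emeasure_eq_measure)
  qed
  finally have "sqdist (indicator B) ?g \<le> ennreal e" .
  moreover have "continuous_on UNIV ?g"
    by (intro continuous_intros continuous_on_compose2[OF \<phi>(1)]) auto
  ultimately show "\<exists>g. g \<in> borel_measurable borel \<and> trig_approx g \<and> sqdist (indicator B) g \<le> ennreal e"
    using trig_approx_continuous[OF \<phi>(1)] borel_measurable_continuous_onI by blast
qed measurable

text \<open>Simple functions are combinations of indicators, and they converge to \<open>f\<close>
  in square mean by dominated convergence.\<close>

lemma trig_approx_square_integrable:
  assumes f [measurable]: "f \<in> borel_measurable borel"
    and fin: "(\<integral>\<^sup>+x. ennreal ((cmod (f x))\<^sup>2) \<partial>circle) < \<infinity>"
  shows "trig_approx f"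
proof (rule trig_approx_limit)
  fix e :: real assume e: "0 < e"
  obtain s where s: "\<And>i. simple_function borel (s i)" "\<And>x. (\<lambda>i. s i x) \<longlonglongrightarrow> f x"
    "\<And>i x. dist (s i x) 0 \<le> 2 * dist (f x) 0"
    using borel_measurable_implies_sequence_metric[OF f, of 0] by auto
  have [measurable]: "s i \<in> borel_measurable borel" for i
    by (intro borel_measurable_simple_function s)
  have approx: "trig_approx (s i)" for i
  proof -
    have fin: "finite (range (s i))"
      using s(1)[of i] by (simp add: simple_function_def)
    have "s i x = (\<Sum>y\<in>range (s i). y * indicator (s i -` {y}) x)" for x
    proof -
      have "(\<Sum>y\<in>range (s i). y * indicator (s i -` {y}) x) = (\<Sum>y\<in>range (s i). if y = s i x then y else 0)"
        by (intro sum.cong) (auto simp: indicator_def)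
      then show ?thesis
        using fin by (simp add: sum.delta')
    qed
    then have "s i = (\<lambda>x. \<Sum>y\<in>range (s i). y * indicator (s i -` {y}) x)"
      by blast
    moreover have "s i -` {y} \<in> sets borel" for y
      using measurable_sets[of "s i" borel borel "{y}"] by simp
    then have "trig_approx (\<lambda>x. \<Sum>y\<in>range (s i). y * indicator (s i -` {y}) x)"
      by (intro trig_approx_sum trig_approx_cmult trig_approx_indicator fin) auto
    ultimately show ?thesis
      by simp
  qed
  have "(\<lambda>i. sqdist f (s i)) \<longlonglongrightarrow> (\<integral>\<^sup>+x. 0 \<partial>circle)"
    unfolding sqdist_def
  proof (rule nn_integral_dominated_convergence)
    \<comment> \<open>The approximants satisfy |s_i| \<le> 2 |f|, so the difference is at most 3
      |f|, whence the factor 9.\<close>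
    show "AE x in circle. ennreal ((cmod (f x - s i x))\<^sup>2) \<le> 9 * ennreal ((cmod (f x))\<^sup>2)" for i
    proof (intro AE_I2)
      fix x
      have "cmod (f x - s i x) \<le> 3 * cmod (f x)"
        using norm_triangle_ineq4[of "f x" "s i x"] s(3)[of i x] by (simp add: dist_norm)
      then have "(cmod (f x - s i x))\<^sup>2 \<le> (3 * cmod (f x))\<^sup>2"
        by (intro power_mono) auto
      then have "ennreal ((cmod (f x - s i x))\<^sup>2) \<le> ennreal (9 * (cmod (f x))\<^sup>2)"
        by (intro ennreal_leI) (simp add: power_mult_distrib)
      then show "ennreal ((cmod (f x - s i x))\<^sup>2) \<le> 9 * ennreal ((cmod (f x))\<^sup>2)"
        by (simp add: ennreal_mult')
    qed
    show "(\<integral>\<^sup>+x. 9 * ennreal ((cmod (f x))\<^sup>2) \<partial>circle) < \<infinity>"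
      using fin by (simp add: nn_integral_cmult ennreal_mult_less_top)
    show "AE x in circle. (\<lambda>i. ennreal ((cmod (f x - s i x))\<^sup>2)) \<longlonglongrightarrow> 0"
    proof (intro AE_I2)
      fix x
      have "(\<lambda>i. (cmod (f x - s i x))\<^sup>2) \<longlonglongrightarrow> (cmod (f x - f x))\<^sup>2"
        by (intro tendsto_intros s(2))
      then show "(\<lambda>i. ennreal ((cmod (f x - s i x))\<^sup>2)) \<longlonglongrightarrow> 0"
        using tendsto_ennrealI by fastforce
    qed
  qed measurable
  then have "eventually (\<lambda>i. sqdist f (s i) < ennreal e) sequentially"
    using e by (intro order_tendstoD(2)[where y = 0]) auto
  then obtain i where "sqdist f (s i) < ennreal e"
    by (auto simp: eventually_sequentially)
  then show "\<exists>g. g \<in> borel_measurable borel \<and> trig_approx g \<and> sqdist f g \<le> ennreal e"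
    using approx by (intro exI[of _ "s i"]) auto
qed fact

subsection \<open>Orthonormal systems of unimodular functions\<close>

lemma borel_measurable_cnj [measurable]: "cnj \<in> borel_measurable borel"
  by (intro borel_measurable_continuous_onI continuous_intros)

text \<open>Common ground for the circle and the torus. Unimodularity on a probability space makes
  the coefficient integrals converge for every square integrable function. Completeness is a
  separate matter: density on the circle, induction on the dimension on the torus.\<close>

locale unimodular_system = prob_space M for M :: "'a measure" +
  fixes e :: "'i \<Rightarrow> 'a \<Rightarrow> complex" and I :: "'i set"
  assumes e_measurable [measurable]: "\<And>i. e i \<in> borel_measurable M"
    and norm_e: "\<And>i x. cmod (e i x) = 1"
    and orthonormal: "\<And>i j. \<lbrakk>i \<in> I; j \<in> I\<rbrakk> \<Longrightarrow>
      (\<integral>x. e i x * cnj (e j x) \<partial>M) = (if i = j then 1 else 0)"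
begin

definition coeff :: "('a \<Rightarrow> complex) \<Rightarrow> 'i \<Rightarrow> complex" where
  "coeff f i = (\<integral>x. f x * cnj (e i x) \<partial>M)"

definition square_integrable :: "('a \<Rightarrow> complex) \<Rightarrow> bool" where
  "square_integrable f \<longleftrightarrow> f \<in> borel_measurable M \<and> integrable M (\<lambda>x. (cmod (f x))\<^sup>2)"

lemma square_integrableD:
  assumes "square_integrable f"
  shows "f \<in> borel_measurable M" "integrable M (\<lambda>x. (cmod (f x))\<^sup>2)"
    "integrable M f" "integrable M (\<lambda>x. f x * cnj (e i x))"
proof -
  show meas [measurable]: "f \<in> borel_measurable M" and sq: "integrable M (\<lambda>x. (cmod (f x))\<^sup>2)"
    using assms by (auto simp: square_integrable_def)
  have le: "cmod z \<le> 1 + (cmod z)\<^sup>2" for z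
    using zero_le_power2[of "cmod z - 1/2"] by (simp add: power2_eq_square algebra_simps)
  have int: "integrable M (\<lambda>x. 1 + (cmod (f x))\<^sup>2)"
    using sq by auto
  show "integrable M f"
    by (rule Bochner_Integration.integrable_bound[OF int]) (auto simp: le)
  show "integrable M (\<lambda>x. f x * cnj (e i x))"
    by (rule Bochner_Integration.integrable_bound[OF int]) (auto simp: le norm_mult norm_e)
qed

lemma square_integrableI_nn:
  assumes [measurable]: "f \<in> borel_measurable M"
    and "(\<integral>\<^sup>+x. ennreal ((cmod (f x))\<^sup>2) \<partial>M) < \<infinity>"
  shows "square_integrable f"
  using assms by (auto simp: square_integrable_def integrable_iff_bounded)

lemma cmod_diff_mult_sq:
  fixes z c w :: complex
  assumes "cmod w = 1"
  shows "(cmod (z - c * w))\<^sup>2 = (cmod z)\<^sup>2 - 2 * Re (cnj c * (z * cnj w)) + (cmod c)\<^sup>2"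
proof -
  have w: "w * cnj w = 1"
    using assms by (simp add: complex_norm_square[symmetric])
  have "complex_of_real ((cmod (z - c * w))\<^sup>2) = (z - c * w) * (cnj z - cnj c * cnj w)"
    by (simp only: complex_norm_square complex_cnj_diff complex_cnj_mult)
  also have "\<dots> = z * cnj z - (cnj c * (z * cnj w) + cnj (cnj c * (z * cnj w))) + c * cnj c * (w * cnj w)"
    by (simp add: algebra_simps)
  also have "\<dots> = complex_of_real ((cmod z)\<^sup>2 - 2 * Re (cnj c * (z * cnj w)) + (cmod c)\<^sup>2)"
    unfolding w complex_add_cnj by (simp add: complex_norm_square del: of_real_power)
  finally show ?thesis
    unfolding of_real_eq_iff .
qed

text \<open>Integrate the pointwise expansion of the square and complete the square in
  \<open>c\<close>. The value \<open>c = coeff f i\<close> is optimal and removes exactly the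
  squared coefficient.\<close>

lemma square_integrable_diff_basis:
  assumes "square_integrable f"
  shows "square_integrable (\<lambda>x. f x - c * e i x)"
    and "(\<integral>x. (cmod (f x - c * e i x))\<^sup>2 \<partial>M)
      = (\<integral>x. (cmod (f x))\<^sup>2 \<partial>M) + (cmod (c - coeff f i))\<^sup>2 - (cmod (coeff f i))\<^sup>2"
proof -
  note f = square_integrableD[OF assms]
  note f(1) [measurable]
  have eq: "(\<lambda>x. (cmod (f x - c * e i x))\<^sup>2)
      = (\<lambda>x. (cmod (f x))\<^sup>2 - 2 * Re (cnj c * (f x * cnj (e i x))) + (cmod c)\<^sup>2)"
    by (intro ext cmod_diff_mult_sq norm_e)
  have int: "integrable M (\<lambda>x. Re (cnj c * (f x * cnj (e i x))))"
    by (intro integrable_Re integrable_mult_right f(4))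
  show "square_integrable (\<lambda>x. f x - c * e i x)"
    unfolding square_integrable_def eq
    by (intro conjI Bochner_Integration.integrable_add Bochner_Integration.integrable_diff integrable_mult_right f(2) int integrable_const) measurable
  have "(\<integral>x. Re (cnj c * (f x * cnj (e i x))) \<partial>M) = Re (cnj c * coeff f i)"
    using integral_Re[OF integrable_mult_right[OF f(4)], of "cnj c" i] by (simp only: coeff_def integral_mult_right_zero)
  then have "(\<integral>x. (cmod (f x - c * e i x))\<^sup>2 \<partial>M)
      = (\<integral>x. (cmod (f x))\<^sup>2 \<partial>M) - 2 * Re (cnj c * coeff f i) + (cmod c)\<^sup>2"
    unfolding eq using f(2) int
    by (simp add: prob_space del: times_complex.sel)
  also have "\<dots> = (\<integral>x. (cmod (f x))\<^sup>2 \<partial>M) + (cmod (c - coeff f i))\<^sup>2 - (cmod (coeff f i))\<^sup>2"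
    using cmod_diff_mult_sq[of 1 c "coeff f i"]
    by (simp add: cmod_power2 power2_eq_square algebra_simps)
  finally show "(\<integral>x. (cmod (f x - c * e i x))\<^sup>2 \<partial>M)
      = (\<integral>x. (cmod (f x))\<^sup>2 \<partial>M) + (cmod (c - coeff f i))\<^sup>2 - (cmod (coeff f i))\<^sup>2" .
qed

lemma coeff_diff_sum:
  assumes f: "square_integrable f" and F: "finite F" "F \<subseteq> I" and i: "i \<in> I"
  shows "coeff (\<lambda>x. f x - (\<Sum>k\<in>F. c k * e k x)) i = coeff f i - (if i \<in> F then c i else 0)"
proof -
  have int: "integrable M (\<lambda>x. e k x * cnj (e i x))" for k
    by (rule Bochner_Integration.integrable_bound[of M "\<lambda>_. 1::real"]) (auto simp: norm_mult norm_e)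
  have "coeff (\<lambda>x. f x - (\<Sum>k\<in>F. c k * e k x)) i
      = (\<integral>x. f x * cnj (e i x) - (\<Sum>k\<in>F. c k * (e k x * cnj (e i x))) \<partial>M)"
    by (simp add: coeff_def algebra_simps sum_distrib_left sum_distrib_right)
  also have "\<dots> = coeff f i - (\<Sum>k\<in>F. c k * (\<integral>x. e k x * cnj (e i x) \<partial>M))"
    using square_integrableD[OF f] int by (simp add: coeff_def)
  also have "(\<Sum>k\<in>F. c k * (\<integral>x. e k x * cnj (e i x) \<partial>M)) = (\<Sum>k\<in>F. if k = i then c k else 0)"
    using F i by (intro sum.cong) (auto simp: orthonormal)
  also have "\<dots> = (if i \<in> F then c i else 0)"
    using F by simp
  finally show ?thesis .
qed

text \<open>Basis functions are subtracted one at a time. By orthonormality the earlier subtractions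
  leave the coefficient at a new index unchanged, so the one-term identity applies again.\<close>

lemma square_integrable_diff_sum:
  assumes f: "square_integrable f" and F: "finite F" "F \<subseteq> I"
  shows "square_integrable (\<lambda>x. f x - (\<Sum>k\<in>F. c k * e k x))"
    and "(\<integral>x. (cmod (f x - (\<Sum>k\<in>F. c k * e k x)))\<^sup>2 \<partial>M)
      = (\<integral>x. (cmod (f x))\<^sup>2 \<partial>M) + (\<Sum>k\<in>F. (cmod (c k - coeff f k))\<^sup>2 - (cmod (coeff f k))\<^sup>2)"
proof -
  have "square_integrable (\<lambda>x. f x - (\<Sum>k\<in>F. c k * e k x)) \<and>
    (\<integral>x. (cmod (f x - (\<Sum>k\<in>F. c k * e k x)))\<^sup>2 \<partial>M)
      = (\<integral>x. (cmod (f x))\<^sup>2 \<partial>M) + (\<Sum>k\<in>F. (cmod (c k - coeff f k))\<^sup>2 - (cmod (coeff f k))\<^sup>2)"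
    using F
  proof (induction F)
    case (insert i F)
    let ?g = "\<lambda>x. f x - (\<Sum>k\<in>F. c k * e k x)"
    have g: "square_integrable ?g" "coeff ?g i = coeff f i"
      using insert coeff_diff_sum[OF f, of F i c] by auto
    have "(\<lambda>x. f x - (\<Sum>k\<in>insert i F. c k * e k x)) = (\<lambda>x. ?g x - c i * e i x)"
      using insert by (simp add: algebra_simps)
    then show ?case
      using square_integrable_diff_basis[OF g(1), of "c i" i] insert g(2)
      by (simp add: diff_diff_add add.commute)
  qed (use f in simp)
  then show "square_integrable (\<lambda>x. f x - (\<Sum>k\<in>F. c k * e k x))"
    and "(\<integral>x. (cmod (f x - (\<Sum>k\<in>F. c k * e k x)))\<^sup>2 \<partial>M)
      = (\<integral>x. (cmod (f x))\<^sup>2 \<partial>M) + (\<Sum>k\<in>F. (cmod (c k - coeff f k))\<^sup>2 - (cmod (coeff f k))\<^sup>2)"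
    by auto
qed

lemma square_integrable_sum:
  assumes F: "finite F" "F \<subseteq> I"
  shows "square_integrable (\<lambda>x. \<Sum>k\<in>F. c k * e k x)"
    and "(\<integral>x. (cmod (\<Sum>k\<in>F. c k * e k x))\<^sup>2 \<partial>M) = (\<Sum>k\<in>F. (cmod (c k))\<^sup>2)"
    and "i \<in> I \<Longrightarrow> coeff (\<lambda>x. \<Sum>k\<in>F. c k * e k x) i = (if i \<in> F then c i else 0)"
proof -
  have 0: "square_integrable (\<lambda>_. 0)" "coeff (\<lambda>_. 0) = (\<lambda>_. 0)"
    by (auto simp: square_integrable_def coeff_def)
  show "square_integrable (\<lambda>x. \<Sum>k\<in>F. c k * e k x)"
    using square_integrable_diff_sum(1)[OF 0(1) F, of "\<lambda>k. - c k"] by (simp add: sum_negf)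
  show "(\<integral>x. (cmod (\<Sum>k\<in>F. c k * e k x))\<^sup>2 \<partial>M) = (\<Sum>k\<in>F. (cmod (c k))\<^sup>2)"
    using square_integrable_diff_sum(2)[OF 0(1) F, of c] 0(2) by simp
  show "i \<in> I \<Longrightarrow> coeff (\<lambda>x. \<Sum>k\<in>F. c k * e k x) i = (if i \<in> F then c i else 0)"
    using coeff_diff_sum[OF 0(1) F, of i "\<lambda>k. - c k"] 0(2) by (simp add: sum_negf split: if_splits)
qed

lemma coeff_sq_le:
  assumes "square_integrable f"
  shows "(cmod (coeff f i))\<^sup>2 \<le> (\<integral>x. (cmod (f x))\<^sup>2 \<partial>M)"
proof -
  have "0 \<le> (\<integral>x. (cmod (f x - coeff f i * e i x))\<^sup>2 \<partial>M)"
    by (intro integral_nonneg_AE) auto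
  then show ?thesis
    using square_integrable_diff_basis(2)[OF assms, of "coeff f i" i] by simp
qed

text \<open>The squared error of any approximant supported on \<open>F\<close> equals the squared
  norm of \<open>f\<close>, minus the squared coefficients on \<open>F\<close>, plus the nonnegative
  terms |c_k - coeff f k|^2. An error below \<open>\<epsilon>\<close> therefore forces the
  coefficients on \<open>F\<close> to carry all but \<open>\<epsilon>\<close> of the norm, whatever
  the \<open>c k\<close> are.\<close>

lemma parseval_le_if_dense:
  assumes f: "square_integrable f"
    and dense: "\<And>\<epsilon>::real. 0 < \<epsilon> \<Longrightarrow> \<exists>F c. finite F \<and> F \<subseteq> I \<and>
      (\<integral>\<^sup>+x. ennreal ((cmod (f x - (\<Sum>k\<in>F. c k * e k x)))\<^sup>2) \<partial>M) \<le> ennreal \<epsilon>"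
  shows "(\<integral>\<^sup>+x. ennreal ((cmod (f x))\<^sup>2) \<partial>M) \<le> (\<integral>\<^sup>+i. ennreal ((cmod (coeff f i))\<^sup>2) \<partial>count_space I)"
proof (rule ennreal_le_epsilon)
  fix \<epsilon> :: real assume \<epsilon>: "0 < \<epsilon>"
  let ?a = "\<lambda>i. (cmod (coeff f i))\<^sup>2"
  obtain F c where F: "finite F" "F \<subseteq> I"
    and le: "(\<integral>\<^sup>+x. ennreal ((cmod (f x - (\<Sum>k\<in>F. c k * e k x)))\<^sup>2) \<partial>M) \<le> ennreal \<epsilon>"
    using dense[OF \<epsilon>] by blast
  let ?g = "\<lambda>x. f x - (\<Sum>k\<in>F. c k * e k x)"
  note g = square_integrable_diff_sum[OF f F, of c]
  have "(\<integral>\<^sup>+x. ennreal ((cmod (?g x))\<^sup>2) \<partial>M) = ennreal (\<integral>x. (cmod (?g x))\<^sup>2 \<partial>M)"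
    using square_integrableD(2)[OF g(1)] by (intro nn_integral_eq_integral) auto
  then have "(\<integral>x. (cmod (?g x))\<^sup>2 \<partial>M) \<le> \<epsilon>"
    using le \<epsilon> by simp
  then have 1: "(\<integral>x. (cmod (f x))\<^sup>2 \<partial>M) \<le> \<epsilon> + (\<Sum>k\<in>F. ?a k)"
    unfolding g(2) sum_subtractf
    using sum_nonneg[of F "\<lambda>k. (cmod (c k - coeff f k))\<^sup>2"] by auto
  have "(\<integral>\<^sup>+x. ennreal ((cmod (f x))\<^sup>2) \<partial>M) = ennreal (\<integral>x. (cmod (f x))\<^sup>2 \<partial>M)"
    using square_integrableD(2)[OF f] by (intro nn_integral_eq_integral) auto
  also have "\<dots> \<le> ennreal ((\<Sum>k\<in>F. ?a k) + \<epsilon>)"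
    using 1 by (intro ennreal_leI) simp
  also have "\<dots> = (\<Sum>k\<in>F. ennreal (?a k)) + ennreal \<epsilon>"
    using \<epsilon> by (simp add: sum_nonneg)
  also have "(\<Sum>k\<in>F. ennreal (?a k)) = (\<integral>\<^sup>+i. ennreal (?a i) \<partial>count_space F)"
    using F by (simp add: nn_integral_count_space_finite)
  also have "\<dots> \<le> (\<integral>\<^sup>+i. ennreal (?a i) \<partial>count_space I)"
    using F(2) by (auto simp: nn_integral_count_space_indicator indicator_def intro!: nn_integral_mono)
  finally show "(\<integral>\<^sup>+x. ennreal ((cmod (f x))\<^sup>2) \<partial>M) \<le> (\<integral>\<^sup>+i. ennreal (?a i) \<partial>count_space I) + ennreal \<epsilon>"
    by (simp add: add_right_mono)
qed

lemma square_integrable_lincomb: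
  assumes f: "square_integrable f" and g: "square_integrable g"
  shows "square_integrable (\<lambda>x. a * f x + b * g x)"
    and "coeff (\<lambda>x. a * f x + b * g x) i = a * coeff f i + b * coeff g i"
proof -
  note F = square_integrableD[OF f] and G = square_integrableD[OF g]
  note F(1) [measurable] G(1) [measurable]
  have int: "integrable M (\<lambda>x. 2 * ((cmod a)\<^sup>2 * (cmod (f x))\<^sup>2) + 2 * ((cmod b)\<^sup>2 * (cmod (g x))\<^sup>2))"
    using F(2) G(2) by auto
  have "(cmod (a * f x + b * g x))\<^sup>2 \<le> 2 * ((cmod a)\<^sup>2 * (cmod (f x))\<^sup>2) + 2 * ((cmod b)\<^sup>2 * (cmod (g x))\<^sup>2)" for x
    using cmod_diff_sq_le[of "a * f x" "- (b * g x)" 0] by (simp add: norm_mult power_mult_distrib)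
  then have "integrable M (\<lambda>x. (cmod (a * f x + b * g x))\<^sup>2)"
    by (intro Bochner_Integration.integrable_bound[OF int]) auto
  then show "square_integrable (\<lambda>x. a * f x + b * g x)"
    by (simp add: square_integrable_def)
  have "coeff (\<lambda>x. a * f x + b * g x) i = (\<integral>x. a * (f x * cnj (e i x)) + b * (g x * cnj (e i x)) \<partial>M)"
    by (simp add: coeff_def algebra_simps)
  also have "\<dots> = a * coeff f i + b * coeff g i"
    using F(4) G(4) by (simp add: coeff_def)
  finally show "coeff (\<lambda>x. a * f x + b * g x) i = a * coeff f i + b * coeff g i" .
qed

lemma inj_on_basis: "inj_on e I"
proof (rule inj_onI, rule ccontr)
  fix i j assume ij: "i \<in> I" "j \<in> I" "e i = e j" "i \<noteq> j"
  then have "(\<integral>x. e i x * cnj (e i x) \<partial>M) = 0"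
    using orthonormal[of i j] by simp
  then show False
    using orthonormal[of i i] ij by simp
qed

end

section \<open>Fourier characters on the circle and the torus\<close>

interpretation circle: unimodular_system circle "\<lambda>m x. cis (real_of_int m * x)" UNIV
proof -
  interpret prob_space circle
    by (rule prob_space_circle)
  show "unimodular_system circle (\<lambda>m x. cis (real_of_int m * x)) UNIV"
  proof
    fix i j :: int
    show "(\<lambda>x. cis (real_of_int i * x)) \<in> borel_measurable circle"
      unfolding cis_conv_exp by measurable
    have "(\<lambda>x. cis (real_of_int i * x) * cnj (cis (real_of_int j * x))) = (\<lambda>x. cis (real_of_int (i - j) * x))"
      by (simp add: cis_cnj cis_mult algebra_simps)
    then show "(\<integral>x. cis (real_of_int i * x) * cnj (cis (real_of_int j * x)) \<partial>circle) = (if i = j then 1 else 0)"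
      using integral_circle_cis[of "i - j"] by simp
  qed simp
qed

lemma parseval_le_circle:
  assumes "circle.square_integrable f"
  shows "(\<integral>\<^sup>+x. ennreal ((cmod (f x))\<^sup>2) \<partial>circle)
    \<le> (\<integral>\<^sup>+m. ennreal ((cmod (circle.coeff f m))\<^sup>2) \<partial>count_space UNIV)"
proof (rule circle.parseval_le_if_dense[OF assms])
  note f = circle.square_integrableD[OF assms]
  have "f \<in> borel_measurable borel"
    using f(1) by simp
  moreover have "(\<integral>\<^sup>+x. ennreal ((cmod (f x))\<^sup>2) \<partial>circle) < \<infinity>"
    using f(2) by (subst nn_integral_eq_integral) auto
  ultimately have "trig_approx f"
    by (rule trig_approx_square_integrable)
  then show "\<exists>F c. finite F \<and> F \<subseteq> UNIV \<and>
      (\<integral>\<^sup>+x. ennreal ((cmod (f x - (\<Sum>k\<in>F. c k * cis (real_of_int k * x))))\<^sup>2) \<partial>circle) \<le> ennreal \<epsilon>"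
    if "0 < \<epsilon>" for \<epsilon> :: real
    using that by (auto simp: trig_approx_def sqdist_def trig_sum_def)
qed

lemma integrable_circle_cis: "integrable circle (\<lambda>x. cis (real_of_int m * x))"
  using circle.square_integrableD(3)[OF circle.square_integrable_sum(1)[of "{m}" "\<lambda>_. 1"]] by simp

definition fourier_char :: "nat \<Rightarrow> (nat \<Rightarrow> int) \<Rightarrow> (nat \<Rightarrow> real) \<Rightarrow> complex" where
  "fourier_char d k x = cis (\<Sum>j<d. real_of_int (k j) * x j)"

lemma product_sigma_finite_circle: "product_sigma_finite (\<lambda>_::nat. circle)"
  by unfold_locales

lemma prob_space_torus: "prob_space (torus d)"
  unfolding torus_def by (intro prob_space_PiM prob_space_circle)

text \<open>Orthonormality factorizes over the coordinates by Fubini. Distinct lattice points differ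
  at some index below \<open>d\<close>, as both vanish beyond, and the factor of that coordinate is
  zero.\<close>

interpretation torus: unimodular_system "torus d" "fourier_char d" "lattice d" for d
proof -
  interpret prob_space "torus d"
    by (rule prob_space_torus)
  show "unimodular_system (torus d) (fourier_char d) (lattice d)"
  proof
    fix k l :: "nat \<Rightarrow> int"
    show "fourier_char d k \<in> borel_measurable (torus d)"
      unfolding fourier_char_def[abs_def] cis_conv_exp torus_def
      by (intro borel_measurable_exp measurable_compose[OF _ borel_measurable_exp])
         (auto intro!: borel_measurable_times borel_measurable_sum borel_measurable_of_real)
    show "cmod (fourier_char d k x) = 1" for x
      by (simp add: fourier_char_def)
    assume kl: "k \<in> lattice d" "l \<in> lattice d"
    have "fourier_char d k x * cnj (fourier_char d l x) = (\<Prod>j<d. cis (real_of_int (k j - l j) * x j))" for x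
    proof -
      have "fourier_char d k x * cnj (fourier_char d l x) = cis (\<Sum>j<d. real_of_int (k j - l j) * x j)"
        by (simp add: fourier_char_def cis_cnj cis_mult sum_subtractf[symmetric] left_diff_distrib)
      also have "\<dots> = (\<Prod>j<d. cis (real_of_int (k j - l j) * x j))"
        by (simp only: cis_conv_exp of_real_sum sum_distrib_left exp_sum[OF finite_lessThan])
      finally show ?thesis .
    qed
    then have "(\<integral>x. fourier_char d k x * cnj (fourier_char d l x) \<partial>torus d)
        = (\<Prod>j<d. \<integral>x. cis (real_of_int (k j - l j) * x) \<partial>circle)"
      unfolding torus_def
      using product_sigma_finite.product_integral_prod[OF product_sigma_finite_circle finite_lessThan integrable_circle_cis]
      by (simp del: of_int_diff)
    also have "\<dots> = (if k = l then 1 else 0)"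
    proof (cases "k = l")
      case False
      then obtain j where j: "k j \<noteq> l j"
        by auto
      with kl have "j < d"
        by (auto simp: lattice_def) (metis leI)
      then have "(\<Prod>j<d. \<integral>x. cis (real_of_int (k j - l j) * x) \<partial>circle) = 0"
        using j by (intro prod_zero) (auto simp: integral_circle_cis simp del: of_int_diff)
      then show ?thesis
        using False by simp
    qed (simp add: circle.prob_space)
    finally show "(\<integral>x. fourier_char d k x * cnj (fourier_char d l x) \<partial>torus d) = (if k = l then 1 else 0)" .
  qed
qed

lemma fourier_coeff_eq_coeff: "fourier_coeff d f k = torus.coeff d f k"
  unfolding fourier_coeff_def torus.coeff_def fourier_char_def cis_cnj
  by (simp add: cis_conv_exp)

lemma L2_iff_square_integrable: "f \<in> L2 d \<longleftrightarrow> torus.square_integrable d f"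
  by (simp add: L2_def torus.square_integrable_def)

subsection \<open>Parseval's inequality on the torus\<close>

lemma torus_Suc: "torus (Suc d) = PiM (insert d {..<d}) (\<lambda>_. circle)"
  by (simp add: torus_def lessThan_Suc)

lemma measurable_torus_upd [measurable]:
  "(\<lambda>(x, y). x(d := y)) \<in> torus d \<Otimes>\<^sub>M circle \<rightarrow>\<^sub>M torus (Suc d)"
  unfolding torus_Suc unfolding torus_def by (rule measurable_add_dim)

lemma nn_integral_torus_Suc:
  assumes "f \<in> borel_measurable (torus (Suc d))"
  shows "(\<integral>\<^sup>+x. f x \<partial>torus (Suc d)) = (\<integral>\<^sup>+x. \<integral>\<^sup>+y. f (x(d := y)) \<partial>circle \<partial>torus d)"
  using product_sigma_finite.product_nn_integral_insert[OF product_sigma_finite_circle, of "{..<d}" d f] assms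
  unfolding torus_Suc by (simp add: torus_def)

lemma integral_torus_Suc:
  fixes f :: "(nat \<Rightarrow> real) \<Rightarrow> complex"
  assumes "integrable (torus (Suc d)) f"
  shows "(\<integral>x. f x \<partial>torus (Suc d)) = (\<integral>x. \<integral>y. f (x(d := y)) \<partial>circle \<partial>torus d)"
  using product_sigma_finite.product_integral_insert[OF product_sigma_finite_circle, of "{..<d}" d f] assms
  unfolding torus_Suc by (simp add: torus_def)

lemma bij_betw_lattice_Suc:
  "bij_betw (\<lambda>(m, k). k(d := m)) (UNIV \<times> lattice d) (lattice (Suc d))"
  by (rule bij_betw_byWitness[where f' = "\<lambda>k. (k d, k(d := 0))"])
     (auto simp: lattice_def fun_eq_iff)

lemma nn_integral_lattice_Suc:
  "(\<integral>\<^sup>+m. \<integral>\<^sup>+k. a (k(d := m)) \<partial>count_space (lattice d) \<partial>count_space UNIV)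
    = (\<integral>\<^sup>+k. a k \<partial>count_space (lattice (Suc d)))"
proof -
  have "(\<integral>\<^sup>+m. \<integral>\<^sup>+k. a (k(d := m)) \<partial>count_space (lattice d) \<partial>count_space UNIV)
      = (\<integral>\<^sup>+m. \<integral>\<^sup>+k. a (k(d := m)) * indicator (UNIV \<times> lattice d) (m, k) \<partial>count_space UNIV \<partial>count_space UNIV)"
    by (simp add: nn_integral_count_space_indicator indicator_def cong: if_cong)
  also have "\<dots> = (\<integral>\<^sup>+p. a ((snd p)(d := fst p)) * indicator (UNIV \<times> lattice d) p \<partial>count_space UNIV)"
    using nn_integral_fst_count_space[of "\<lambda>p. a ((snd p)(d := fst p)) * indicator (UNIV \<times> lattice d) p"]
    by simp
  also have "\<dots> = (\<integral>\<^sup>+p. a ((snd p)(d := fst p)) \<partial>count_space (UNIV \<times> lattice d))"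
    by (simp add: nn_integral_count_space_indicator)
  also have "\<dots> = (\<integral>\<^sup>+k. a k \<partial>count_space (lattice (Suc d)))"
    using nn_integral_bij_count_space[OF bij_betw_lattice_Suc[of d], where f = a] by (simp add: case_prod_unfold)
  finally show ?thesis .
qed

text \<open>The integers are enumerated by \<open>int_decode\<close>, so that the exchange becomes
  that of an integral with a series of nonnegative functions.\<close>

lemma nn_integral_sum_int:
  fixes a :: "int \<Rightarrow> 'a \<Rightarrow> ennreal"
  assumes [measurable]: "\<And>m. a m \<in> borel_measurable M"
  shows "(\<integral>\<^sup>+x. \<integral>\<^sup>+m. a m x \<partial>count_space UNIV \<partial>M) = (\<integral>\<^sup>+m. \<integral>\<^sup>+x. a m x \<partial>M \<partial>count_space UNIV)"
proof -
  have eq: "(\<integral>\<^sup>+m. b m \<partial>count_space UNIV) = (\<Sum>n. b (int_decode n))" for b :: "int \<Rightarrow> ennreal"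
    using nn_integral_bij_count_space[of int_decode UNIV UNIV b] bij_int_decode
    by (simp add: nn_integral_count_space_nat)
  show ?thesis
    unfolding eq by (rule nn_integral_suminf) measurable
qed

text \<open>Induction on the dimension. On almost every slice in the last variable the circle
  inequality applies; each slice coefficient \<open>H m\<close> is a function on the smaller torus,
  to which the induction hypothesis applies; the coefficients of all \<open>H m\<close> together are
  those of \<open>f\<close>.\<close>

lemma parseval_le_torus:
  assumes "torus.square_integrable d f"
  shows "(\<integral>\<^sup>+x. ennreal ((cmod (f x))\<^sup>2) \<partial>torus d)
    \<le> (\<integral>\<^sup>+k. ennreal ((cmod (torus.coeff d f k))\<^sup>2) \<partial>count_space (lattice d))"
  using assms
proof (induction d arbitrary: f)
  case 0
  have lattice: "lattice 0 = {\<lambda>_. 0}"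
    by (auto simp: lattice_def)
  have torus: "torus 0 = count_space {\<lambda>_. undefined}"
    by (simp add: torus_def PiM_empty)
  have coeff: "torus.coeff 0 f (\<lambda>_. 0) = f (\<lambda>_. undefined)"
    by (subst torus.coeff_def)
       (simp add: torus lebesgue_integral_count_space_finite fourier_char_def)
  have "(\<integral>\<^sup>+k. ennreal ((cmod (torus.coeff 0 f k))\<^sup>2) \<partial>count_space (lattice 0))
      = ennreal ((cmod (f (\<lambda>_. undefined)))\<^sup>2)"
    unfolding lattice coeff[symmetric] by (subst nn_integral_count_space_finite) simp_all
  then show ?case
    by (simp add: torus nn_integral_count_space_finite)
next
  case (Suc d)
  note f = torus.square_integrableD[OF Suc.prems]
  note f(1) [measurable]
  let ?sl = "\<lambda>x y. f (x(d := y))"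
  have sl [measurable]: "(\<lambda>(x, y). ?sl x y) \<in> borel_measurable (torus d \<Otimes>\<^sub>M circle)"
    using measurable_compose[OF measurable_torus_upd f(1)] by (simp add: case_prod_unfold)
  define H where "H m x = circle.coeff (?sl x) m" for m x
  have H_meas [measurable]: "H m \<in> borel_measurable (torus d)" for m
    unfolding H_def[abs_def] circle.coeff_def
    by (rule circle.borel_measurable_lebesgue_integral) measurable
  have fin: "(\<integral>\<^sup>+x. \<integral>\<^sup>+y. ennreal ((cmod (?sl x y))\<^sup>2) \<partial>circle \<partial>torus d) < \<infinity>"
    using f(2) by (subst nn_integral_torus_Suc[symmetric]) (auto simp: nn_integral_eq_integral)
  have "AE x in torus d. (\<integral>\<^sup>+y. ennreal ((cmod (?sl x y))\<^sup>2) \<partial>circle) \<noteq> \<infinity>"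
    by (rule nn_integral_PInf_AE) (use fin in \<open>auto intro!: circle.borel_measurable_nn_integral\<close>)
  \<comment> \<open>Tonelli gives square integrability only for almost every slice, so all slicewise
    estimates below hold almost everywhere.\<close>
  then have sq: "AE x in torus d. circle.square_integrable (?sl x)"
    using AE_space
  proof eventually_elim
    case (elim x)
    have "?sl x \<in> borel_measurable circle"
      using measurable_Pair2[OF sl elim(2)] by simp
    then show ?case
      using elim(1) by (intro circle.square_integrableI_nn) (auto simp: less_top)
  qed
  have H_sq: "torus.square_integrable d (H m)" for m
  proof (rule torus.square_integrableI_nn)
    have "(\<integral>\<^sup>+x. ennreal ((cmod (H m x))\<^sup>2) \<partial>torus d)
        \<le> (\<integral>\<^sup>+x. \<integral>\<^sup>+y. ennreal ((cmod (?sl x y))\<^sup>2) \<partial>circle \<partial>torus d)"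
    proof (rule nn_integral_mono_AE)
      show "AE x in torus d. ennreal ((cmod (H m x))\<^sup>2) \<le> (\<integral>\<^sup>+y. ennreal ((cmod (?sl x y))\<^sup>2) \<partial>circle)"
        using sq
      proof eventually_elim
        case (elim x)
        have "ennreal ((cmod (H m x))\<^sup>2) \<le> ennreal (\<integral>y. (cmod (?sl x y))\<^sup>2 \<partial>circle)"
          unfolding H_def by (intro ennreal_leI circle.coeff_sq_le elim)
        also have "\<dots> = (\<integral>\<^sup>+y. ennreal ((cmod (?sl x y))\<^sup>2) \<partial>circle)"
          using circle.square_integrableD(2)[OF elim] by (subst nn_integral_eq_integral) auto
        finally show ?case .
      qed
    qed
    then show "(\<integral>\<^sup>+x. ennreal ((cmod (H m x))\<^sup>2) \<partial>torus d) < \<infinity>"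
      using fin by (rule le_less_trans)
  qed measurable
  \<comment> \<open>Fubini: take the coefficient in the last variable first, then the one in the
    remaining variables.\<close>
  have coeff: "torus.coeff (Suc d) f (k(d := m)) = torus.coeff d (H m) k" for k m
  proof -
    have char: "fourier_char (Suc d) (k(d := m)) (x(d := y)) = fourier_char d k x * cis (real_of_int m * y)" for x y
    proof -
      have "(\<Sum>j<d. real_of_int ((k(d := m)) j) * (x(d := y)) j) = (\<Sum>j<d. real_of_int (k j) * x j)"
        by (intro sum.cong) auto
      then show ?thesis
        by (simp add: fourier_char_def cis_mult)
    qed
    have "torus.coeff (Suc d) f (k(d := m))
        = (\<integral>x. \<integral>y. ?sl x y * cnj (fourier_char d k x * cis (real_of_int m * y)) \<partial>circle \<partial>torus d)"
      unfolding torus.coeff_def using f(4) by (subst integral_torus_Suc) (auto simp: char)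
    also have "\<dots> = (\<integral>x. \<integral>y. (?sl x y * cnj (cis (real_of_int m * y))) * cnj (fourier_char d k x) \<partial>circle \<partial>torus d)"
      by (simp add: mult_ac)
    also have "\<dots> = torus.coeff d (H m) k"
      by (simp add: torus.coeff_def H_def circle.coeff_def)
    finally show ?thesis .
  qed
  have "(\<integral>\<^sup>+x. ennreal ((cmod (f x))\<^sup>2) \<partial>torus (Suc d))
      = (\<integral>\<^sup>+x. \<integral>\<^sup>+y. ennreal ((cmod (?sl x y))\<^sup>2) \<partial>circle \<partial>torus d)"
    by (rule nn_integral_torus_Suc) measurable
  also have "\<dots> \<le> (\<integral>\<^sup>+x. \<integral>\<^sup>+m. ennreal ((cmod (H m x))\<^sup>2) \<partial>count_space UNIV \<partial>torus d)"
  proof (rule nn_integral_mono_AE)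
    show "AE x in torus d. (\<integral>\<^sup>+y. ennreal ((cmod (?sl x y))\<^sup>2) \<partial>circle)
        \<le> (\<integral>\<^sup>+m. ennreal ((cmod (H m x))\<^sup>2) \<partial>count_space UNIV)"
      using sq unfolding H_def by eventually_elim (rule parseval_le_circle)
  qed
  also have "\<dots> = (\<integral>\<^sup>+m. \<integral>\<^sup>+x. ennreal ((cmod (H m x))\<^sup>2) \<partial>torus d \<partial>count_space UNIV)"
    by (rule nn_integral_sum_int) measurable
  also have "\<dots> \<le> (\<integral>\<^sup>+m. \<integral>\<^sup>+k. ennreal ((cmod (torus.coeff d (H m) k))\<^sup>2) \<partial>count_space (lattice d) \<partial>count_space UNIV)"
    by (intro nn_integral_mono Suc.IH H_sq)
  also have "\<dots> = (\<integral>\<^sup>+m. \<integral>\<^sup>+k. ennreal ((cmod (torus.coeff (Suc d) f (k(d := m))))\<^sup>2) \<partial>count_space (lattice d) \<partial>count_space UNIV)"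
    by (simp add: coeff)
  also have "\<dots> = (\<integral>\<^sup>+k. ennreal ((cmod (torus.coeff (Suc d) f k))\<^sup>2) \<partial>count_space (lattice (Suc d)))"
    by (rule nn_integral_lattice_Suc)
  finally show ?case .
qed

subsection \<open>Approximation numbers and the weight\<close>

lemma L2_norm_sq: "(L2_norm d f)\<^sup>2 = (\<integral>x. (cmod (f x))\<^sup>2 \<partial>torus d)"
  unfolding L2_norm_def by (intro real_sqrt_pow2 integral_nonneg_AE) auto

text \<open>Serves both the embedding into L2 and the truncation error: Parseval's inequality
  reduces a norm estimate to a termwise comparison of coefficients.\<close>

lemma L2_norm_sq_le:
  assumes h: "h \<in> L2 d" and a: "a summable_on lattice d"
    and le: "\<And>k. k \<in> lattice d \<Longrightarrow> (cmod (fourier_coeff d h k))\<^sup>2 \<le> a k"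
  shows "(L2_norm d h)\<^sup>2 \<le> (\<Sum>\<^sub>\<infinity>k\<in>lattice d. a k)"
proof -
  have a_nonneg: "a k \<ge> 0" if "k \<in> lattice d" for k
    using le[OF that] zero_le_power2 order_trans by blast
  have "(\<lambda>k. norm (a k)) summable_on lattice d"
    using a by (subst summable_on_cong[of _ _ a]) (auto simp: a_nonneg)
  \<comment> \<open>\<open>infsetsum\<close> is the bridge between integrals over a counting measure
    and \<open>infsum\<close>.\<close>
  then have a': "Infinite_Set_Sum.abs_summable_on a (lattice d)"
    using abs_summable_equivalent[of a "lattice d"] by blast
  note sq = h[unfolded L2_iff_square_integrable]
  have "ennreal ((L2_norm d h)\<^sup>2) = (\<integral>\<^sup>+x. ennreal ((cmod (h x))\<^sup>2) \<partial>torus d)"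
    unfolding L2_norm_sq using torus.square_integrableD(2)[OF sq]
    by (intro nn_integral_eq_integral[symmetric]) auto
  also have "\<dots> \<le> (\<integral>\<^sup>+k. ennreal ((cmod (torus.coeff d h k))\<^sup>2) \<partial>count_space (lattice d))"
    by (rule parseval_le_torus[OF sq])
  also have "\<dots> \<le> (\<integral>\<^sup>+k. ennreal (a k) \<partial>count_space (lattice d))"
    using le by (intro nn_integral_mono ennreal_leI) (simp add: fourier_coeff_eq_coeff)
  also have "\<dots> = ennreal (infsetsum a (lattice d))"
    using a' a_nonneg by (rule nn_integral_conv_infsetsum)
  also have "infsetsum a (lattice d) = infsum a (lattice d)"
    using a' by (rule infsetsum_infsum)
  finally show ?thesis
    by (subst (asm) ennreal_le_iff) (auto intro: infsum_nonneg a_nonneg)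
qed

lemma sobolev_norm_sq:
  "(sobolev_norm d R f)\<^sup>2 = (\<Sum>\<^sub>\<infinity>k\<in>lattice d. sob_weight d R k * (cmod (fourier_coeff d f k))\<^sup>2)"
  unfolding sobolev_norm_def
  using order_trans[OF zero_le_one sob_weight_ge_1]
  by (intro real_sqrt_pow2 infsum_nonneg mult_nonneg_nonneg) auto

lemma sobolev_norm_nonneg: "sobolev_norm d R f \<ge> 0"
  unfolding sobolev_norm_def
  using order_trans[OF zero_le_one sob_weight_ge_1]
  by (intro real_sqrt_ge_zero infsum_nonneg mult_nonneg_nonneg) auto

lemma L2_norm_nonneg: "L2_norm d f \<ge> 0"
  unfolding L2_norm_def by (intro real_sqrt_ge_zero integral_nonneg_AE) auto

lemma sobolev_D:
  assumes "f \<in> sobolev d R"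
  shows "f \<in> L2 d" "torus.square_integrable d f"
    "(\<lambda>k. sob_weight d R k * (cmod (torus.coeff d f k))\<^sup>2) summable_on lattice d"
  using assms by (auto simp: sobolev_def L2_iff_square_integrable fourier_coeff_eq_coeff)

lemma coeff_sq_le_weighted: "(cmod z)\<^sup>2 \<le> sob_weight d R k * (cmod z)\<^sup>2"
  using mult_right_mono[OF sob_weight_ge_1[of d R k], of "(cmod z)\<^sup>2"] by simp

lemma L2_norm_le_sobolev_norm:
  assumes "f \<in> sobolev d R"
  shows "L2_norm d f \<le> sobolev_norm d R f"
proof -
  have "(L2_norm d f)\<^sup>2 \<le> (sobolev_norm d R f)\<^sup>2"
    unfolding sobolev_norm_sq
    using sobolev_D[OF assms] by (intro L2_norm_sq_le) (auto simp: fourier_coeff_eq_coeff coeff_sq_le_weighted)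
  then show ?thesis
    using sobolev_norm_nonneg by (rule power2_le_imp_le)
qed

lemma fourier_sum_in_sobolev:
  assumes F: "finite F" "F \<subseteq> lattice d"
  shows "(\<lambda>x. \<Sum>k\<in>F. c k * fourier_char d k x) \<in> sobolev d R"
    and "(sobolev_norm d R (\<lambda>x. \<Sum>k\<in>F. c k * fourier_char d k x))\<^sup>2 = (\<Sum>k\<in>F. sob_weight d R k * (cmod (c k))\<^sup>2)"
    and "(L2_norm d (\<lambda>x. \<Sum>k\<in>F. c k * fourier_char d k x))\<^sup>2 = (\<Sum>k\<in>F. (cmod (c k))\<^sup>2)"
proof -
  let ?f = "\<lambda>x. \<Sum>k\<in>F. c k * fourier_char d k x"
  let ?w = "\<lambda>k. sob_weight d R k * (cmod (fourier_coeff d ?f k))\<^sup>2"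
  let ?v = "\<lambda>k. sob_weight d R k * (cmod (c k))\<^sup>2"
  note s = torus.square_integrable_sum[OF F, where c = c]
  have 0: "?w k = 0" if "k \<in> lattice d - F" for k
    using s(3) that by (simp add: fourier_coeff_eq_coeff)
  have eq: "?w k = ?v k" if "k \<in> F" for k
    using s(3)[of k] that F by (auto simp: fourier_coeff_eq_coeff)
  have "?w summable_on lattice d \<longleftrightarrow> ?v summable_on F"
    by (rule summable_on_cong_neutral) (use 0 eq F in auto)
  then have summable: "?w summable_on lattice d"
    using F by simp
  then show "?f \<in> sobolev d R"
    using s(1) by (simp add: sobolev_def L2_iff_square_integrable)
  have "infsum ?w (lattice d) = infsum ?v F"
    by (rule infsum_cong_neutral) (use 0 eq F in auto)
  then show "(sobolev_norm d R ?f)\<^sup>2 = (\<Sum>k\<in>F. sob_weight d R k * (cmod (c k))\<^sup>2)"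
    unfolding sobolev_norm_sq using F by simp
  show "(L2_norm d ?f)\<^sup>2 = (\<Sum>k\<in>F. (cmod (c k))\<^sup>2)"
    unfolding L2_norm_sq by (rule s(2))
qed

lemma zero_in_sobolev: "(\<lambda>_. 0) \<in> sobolev d R" and sobolev_norm_zero: "sobolev_norm d R (\<lambda>_. 0) = 0"
  using fourier_sum_in_sobolev(1,2)[of "{}" d, where R = R] by auto

text \<open>Gaussian elimination for a homogeneous system with the equations indexed by
  \<open>G\<close> and more unknowns, indexed by \<open>K\<close>. An equation that is not
  identically zero removes one unknown \<open>k0\<close> as pivot.\<close>

lemma ex_nontrivial_kernel:
  fixes m :: "'k \<Rightarrow> 'g \<Rightarrow> 'f::field"
  assumes "finite G" "finite K" "card G < card K"
  shows "\<exists>c. (\<exists>k\<in>K. c k \<noteq> 0) \<and> (\<forall>g\<in>G. (\<Sum>k\<in>K. c k * m k g) = 0)"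
  using assms
proof (induction G arbitrary: K m rule: finite_induct)
  case empty
  then have "K \<noteq> {}"
    by auto
  then show ?case
    by (intro exI[of _ "\<lambda>_. 1"]) auto
next
  case (insert g G)
  show ?case
  proof (cases "\<forall>k\<in>K. m k g = 0")
    case True
    obtain c where "\<exists>k\<in>K. c k \<noteq> 0" "\<forall>g\<in>G. (\<Sum>k\<in>K. c k * m k g) = 0"
      using insert.IH[of K m] insert.prems insert.hyps by auto
    then show ?thesis
      using True by (intro exI[of _ c]) auto
  next
    case False
    then obtain k0 where k0: "k0 \<in> K" "m k0 g \<noteq> 0"
      by auto
    define m' where "m' k h = m k h - m k g / m k0 g * m k0 h" for k h
    have "card G < card (K - {k0})"
      using insert.prems insert.hyps k0 by simp
    then obtain c where c: "\<exists>k\<in>K - {k0}. c k \<noteq> 0" "\<forall>h\<in>G. (\<Sum>k\<in>K - {k0}. c k * m' k h) = 0"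
      using insert.IH[of "K - {k0}" m'] insert.prems(1) by blast
    \<comment> \<open>The value at the pivot solves equation \<open>g\<close> and makes every sum
      over \<open>K\<close> with \<open>m\<close> equal to the reduced sum with \<open>m'\<close>,
      whose column \<open>g\<close> vanishes.\<close>
    define c' where "c' k = (if k = k0 then - (\<Sum>k\<in>K - {k0}. c k * m k g / m k0 g) else c k)" for k
    have "(\<Sum>k\<in>K. c' k * m k h) = (\<Sum>k\<in>K - {k0}. c k * m' k h)" for h
    proof -
      have "(\<Sum>k\<in>K. c' k * m k h) = c' k0 * m k0 h + (\<Sum>k\<in>K - {k0}. c' k * m k h)"
        using k0 insert.prems by (subst sum.remove[of K k0]) auto
      also have "(\<Sum>k\<in>K - {k0}. c' k * m k h) = (\<Sum>k\<in>K - {k0}. c k * m k h)"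
        by (intro sum.cong) (auto simp: c'_def)
      finally show ?thesis
        by (simp add: c'_def m'_def sum_distrib_left sum_distrib_right right_diff_distrib sum_subtractf mult_ac)
    qed
    moreover have "m' k g = 0" for k
      using k0 by (simp add: m'_def)
    ultimately have "\<forall>h\<in>insert g G. (\<Sum>k\<in>K. c' k * m k h) = 0"
      using c(2) by simp
    moreover have "\<exists>k\<in>K. c' k \<noteq> 0"
      using c(1) by (auto simp: c'_def)
    ultimately show ?thesis
      by blast
  qed
qed

text \<open>A supremum of reals bounds the members of its set only when the set is bounded above, so
  this comes before any use of \<open>op_dist\<close> from below.\<close>

lemma op_dist_bdd_above:
  assumes "admissible d R n A"
  shows "bdd_above {L2_norm d (\<lambda>x. f x - A f x) | f. f \<in> sobolev d R \<and> sobolev_norm d R f \<le> 1}"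
proof -
  obtain B where B: "\<forall>f\<in>sobolev d R. L2_norm d (A f) \<le> B * sobolev_norm d R f"
    and A: "\<forall>f\<in>sobolev d R. A f \<in> L2 d"
    using assms by (auto simp: admissible_def)
  have "L2_norm d (\<lambda>x. f x - A f x) \<le> sqrt (2 + 2 * B\<^sup>2)" if f: "f \<in> sobolev d R" "sobolev_norm d R f \<le> 1" for f
  proof -
    have "L2_norm d f \<le> 1"
      using L2_norm_le_sobolev_norm[OF f(1)] f(2) by simp
    then have 1: "(L2_norm d f)\<^sup>2 \<le> 1"
      using L2_norm_nonneg by (simp add: power_le_one)
    have "L2_norm d (A f) \<le> B * sobolev_norm d R f"
      using B f by blast
    also have "\<dots> \<le> \<bar>B\<bar> * 1"
      using f(2) sobolev_norm_nonneg by (intro mult_mono) auto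
    finally have 2: "(L2_norm d (A f))\<^sup>2 \<le> B\<^sup>2"
      using L2_norm_nonneg by (metis abs_le_square_iff abs_of_nonneg mult.right_neutral)
    note sq = torus.square_integrableD(2)[OF sobolev_D(2)[OF f(1)]]
      torus.square_integrableD(2)[of d "A f"]
    have Af: "torus.square_integrable d (A f)"
      using A f by (auto simp: L2_iff_square_integrable)
    have "(L2_norm d (\<lambda>x. f x - A f x))\<^sup>2 \<le> (\<integral>x. 2 * (cmod (f x))\<^sup>2 + 2 * (cmod (A f x))\<^sup>2 \<partial>torus d)"
      unfolding L2_norm_sq
    proof (rule integral_mono)
      show "integrable (torus d) (\<lambda>x. (cmod (f x - A f x))\<^sup>2)"
        using torus.square_integrable_lincomb(1)[OF sobolev_D(2)[OF f(1)] Af, of 1 "-1"]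
        by (auto dest: torus.square_integrableD(2))
      show "integrable (torus d) (\<lambda>x. 2 * (cmod (f x))\<^sup>2 + 2 * (cmod (A f x))\<^sup>2)"
        using sq Af by auto
      show "(cmod (f x - A f x))\<^sup>2 \<le> 2 * (cmod (f x))\<^sup>2 + 2 * (cmod (A f x))\<^sup>2" for x
        using cmod_diff_sq_le[of "f x" "A f x" 0] by simp
    qed
    also have "\<dots> = 2 * (L2_norm d f)\<^sup>2 + 2 * (L2_norm d (A f))\<^sup>2"
      unfolding L2_norm_sq using sq Af by simp
    also have "\<dots> \<le> 2 + 2 * B\<^sup>2"
      using 1 2 by simp
    finally show ?thesis
      by (rule real_le_rsqrt)
  qed
  then show ?thesis
    by (intro bdd_aboveI[of _ "sqrt (2 + 2 * B\<^sup>2)"]) auto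
qed

lemma op_dist_ge:
  assumes "admissible d R n A" "f \<in> sobolev d R" "sobolev_norm d R f \<le> 1"
  shows "L2_norm d (\<lambda>x. f x - A f x) \<le> op_dist d R A"
  unfolding op_dist_def by (rule cSup_upper[OF _ op_dist_bdd_above[OF assms(1)]]) (use assms in blast)

lemma admissible_zero:
  assumes "n \<ge> 1"
  shows "admissible d R n (\<lambda>_ _. 0)"
proof -
  have "L2_norm d (\<lambda>_. 0) = 0" "(\<lambda>_. 0) \<in> L2 d"
    by (auto simp: L2_norm_def L2_def)
  then show ?thesis
    unfolding admissible_def ae_eq_def using assms
    by (intro conjI exI[of _ 0] exI[of _ "{}"]) auto
qed

text \<open>Linearity is given for two functions at a time and only almost everywhere; finitely many
  exceptional null sets are collected along the induction.\<close>

lemma admissible_sum: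
  assumes A: "admissible d R n A" and F: "finite F" "F \<subseteq> lattice d"
  shows "ae_eq d (A (\<lambda>x. \<Sum>k\<in>F. c k * fourier_char d k x)) (\<lambda>x. \<Sum>k\<in>F. c k * A (fourier_char d k) x)"
  using F
proof (induction F)
  case empty
  have "ae_eq d (A (\<lambda>_. 0)) (\<lambda>_. 0)"
    using A zero_in_sobolev[of d R] by (auto simp: admissible_def ae_eq_def)
  then show ?case
    by simp
next
  case (insert k F)
  let ?s = "\<lambda>x. \<Sum>k\<in>F. c k * fourier_char d k x"
  have lin: "\<forall>f\<in>sobolev d R. \<forall>g\<in>sobolev d R. \<forall>a b :: complex.
        ae_eq d (A (\<lambda>x. a * f x + b * g x)) (\<lambda>x. a * A f x + b * A g x)"
    using A by (simp add: admissible_def)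
  have "fourier_char d k \<in> sobolev d R" "?s \<in> sobolev d R"
    using fourier_sum_in_sobolev(1)[of "{k}" d "\<lambda>_. 1" R] fourier_sum_in_sobolev(1)[of F d c R] insert
    by auto
  from lin[rule_format, OF this, of "c k" 1]
  have 1: "ae_eq d (A (\<lambda>x. c k * fourier_char d k x + 1 * ?s x)) (\<lambda>x. c k * A (fourier_char d k) x + 1 * A ?s x)" .
  have 2: "ae_eq d (A ?s) (\<lambda>x. \<Sum>k\<in>F. c k * A (fourier_char d k) x)"
    using insert by simp
  show ?case
    using 1 2 unfolding ae_eq_def by eventually_elim (use insert.hyps in simp)
qed

text \<open>An operator of rank below \<open>n\<close> annihilates a nonzero combination of the
  characters from \<open>K\<close>, up to a null set. Its error there is the full L2 norm, and this
  is at least 1 / sqrt W times the Sobolev norm, because all weights on \<open>K\<close> are at most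
  \<open>W\<close>.\<close>

lemma approx_num_ge:
  assumes K: "finite K" "K \<subseteq> lattice d" "n \<le> card K" and n: "n \<ge> 1"
    and W: "0 < W" "\<And>k. k \<in> K \<Longrightarrow> sob_weight d R k \<le> W"
  shows "1 / sqrt W \<le> approx_num d R n"
  unfolding approx_num_def
proof (rule cInf_greatest)
  show "{op_dist d R A |A. admissible d R n A} \<noteq> {}"
    using admissible_zero[OF n] by blast
next
  fix y assume "y \<in> {op_dist d R A |A. admissible d R n A}"
  then obtain A where A: "admissible d R n A" and y: "y = op_dist d R A"
    by auto
  obtain G where G: "finite G" "card G < n"
    and rank: "\<forall>f\<in>sobolev d R. \<exists>c. ae_eq d (A f) (\<lambda>x. \<Sum>g\<in>G. c g * g x)"
    using A by (auto simp: admissible_def)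
  have "fourier_char d k \<in> sobolev d R" if "k \<in> K" for k
    using fourier_sum_in_sobolev(1)[of "{k}" d "\<lambda>_. 1" R] that K by auto
  then have "\<forall>k\<in>K. \<exists>c. ae_eq d (A (fourier_char d k)) (\<lambda>x. \<Sum>g\<in>G. c g * g x)"
    using rank by blast
  from bchoice[OF this] obtain m
    where m: "\<forall>k\<in>K. ae_eq d (A (fourier_char d k)) (\<lambda>x. \<Sum>g\<in>G. m k g * g x)"
    by blast
  have "card G < card K"
    using G K by simp
  then obtain c where c: "\<exists>k\<in>K. c k \<noteq> 0" "\<forall>g\<in>G. (\<Sum>k\<in>K. c k * m k g) = 0"
    using ex_nontrivial_kernel[OF G(1) K(1), of m] by blast
  define S where "S = (\<Sum>k\<in>K. (cmod (c k))\<^sup>2)"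
  have S: "S > 0"
  proof -
    obtain k where "k \<in> K" "c k \<noteq> 0"
      using c(1) by blast
    then show ?thesis
      unfolding S_def using K(1) by (intro sum_pos2[of _ k]) auto
  qed
  \<comment> \<open>Normalized so that the squared coefficients sum to 1/W. Then the Sobolev norm is
    at most 1 and the L2 norm equals 1 / sqrt W.\<close>
  define b where "b k = c k / complex_of_real (sqrt (W * S))" for k
  have b: "(\<Sum>k\<in>K. (cmod (b k))\<^sup>2) = 1 / W"
  proof -
    have "(\<Sum>k\<in>K. (cmod (b k))\<^sup>2) = (\<Sum>k\<in>K. (cmod (c k))\<^sup>2) / (W * S)"
      using W S by (simp add: b_def norm_divide power_divide sum_divide_distrib)
    then show ?thesis
      using S by (simp add: S_def[symmetric])
  qed
  let ?f = "\<lambda>x. \<Sum>k\<in>K. b k * fourier_char d k x"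
  note f = fourier_sum_in_sobolev(1,2)[OF K(1,2), where c = b and R = R]
    fourier_sum_in_sobolev(3)[OF K(1,2), where c = b]
  have "(sobolev_norm d R ?f)\<^sup>2 \<le> (\<Sum>k\<in>K. W * (cmod (b k))\<^sup>2)"
    unfolding f(2) using W by (intro sum_mono mult_right_mono) auto
  also have "\<dots> = 1"
    using b W by (simp add: sum_distrib_left[symmetric])
  finally have norm_f: "sobolev_norm d R ?f \<le> 1"
    using power2_le_imp_le[of "sobolev_norm d R ?f" 1] by simp
  have "AE x in torus d. A ?f x = (\<Sum>k\<in>K. b k * A (fourier_char d k) x)"
    using admissible_sum[OF A K(1,2), of b] by (simp add: ae_eq_def)
  moreover have "AE x in torus d. \<forall>k\<in>K. A (fourier_char d k) x = (\<Sum>g\<in>G. m k g * g x)"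
    using m K(1) by (intro AE_finite_allI) (auto simp: ae_eq_def)
  ultimately have "AE x in torus d. A ?f x = 0"
  proof eventually_elim
    case (elim x)
    have "A ?f x = (\<Sum>k\<in>K. \<Sum>g\<in>G. b k * (m k g * g x))"
      using elim by (simp add: sum_distrib_left)
    also have "\<dots> = (\<Sum>g\<in>G. (\<Sum>k\<in>K. b k * m k g) * g x)"
      by (subst sum.swap) (simp add: sum_distrib_left sum_distrib_right mult_ac)
    also have "(\<Sum>g\<in>G. (\<Sum>k\<in>K. b k * m k g) * g x) = 0"
    proof (rule sum.neutral, rule ballI)
      fix g assume "g \<in> G"
      have "(\<Sum>k\<in>K. b k * m k g) = (\<Sum>k\<in>K. c k * m k g) / complex_of_real (sqrt (W * S))"
        by (simp add: b_def sum_divide_distrib)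
      then show "(\<Sum>k\<in>K. b k * m k g) * g x = 0"
        using c(2) \<open>g \<in> G\<close> by simp
    qed
    finally show ?case .
  qed
  moreover have "A ?f \<in> borel_measurable (torus d)" "?f \<in> borel_measurable (torus d)"
    using A f(1) by (auto simp: admissible_def L2_def sobolev_def)
  ultimately have "(L2_norm d (\<lambda>x. ?f x - A ?f x))\<^sup>2 = (L2_norm d ?f)\<^sup>2"
    unfolding L2_norm_sq by (intro integral_cong_AE) auto
  also have "\<dots> = 1 / W"
    unfolding f(3) b ..
  finally have "L2_norm d (\<lambda>x. ?f x - A ?f x) = sqrt (1 / W)"
    by (intro real_sqrt_unique[symmetric] L2_norm_nonneg)
  then show "1 / sqrt W \<le> y"
    using op_dist_ge[OF A f(1) norm_f] y by (simp add: real_sqrt_divide)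
qed

section \<open>Upper bounds by truncating the Fourier series\<close>

lemma admissible_partial_sum:
  assumes F: "finite F" "F \<subseteq> lattice d" "card F < n"
  shows "admissible d R n (\<lambda>f x. \<Sum>k\<in>F. torus.coeff d f k * fourier_char d k x)"
proof -
  let ?A = "\<lambda>f x. \<Sum>k\<in>F. torus.coeff d f k * fourier_char d k x"
  note s = torus.square_integrable_sum[OF F(1,2)]
  have "\<forall>f\<in>sobolev d R. ?A f \<in> L2 d"
    using s(1) by (simp add: L2_iff_square_integrable)
  moreover have "\<forall>f\<in>sobolev d R. \<forall>g\<in>sobolev d R. \<forall>a b :: complex.
      ae_eq d (?A (\<lambda>x. a * f x + b * g x)) (\<lambda>x. a * ?A f x + b * ?A g x)"
    by (auto simp: ae_eq_def torus.square_integrable_lincomb(2) sobolev_D sum_distrib_left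
        sum.distrib[symmetric] algebra_simps)
  moreover have "\<forall>f\<in>sobolev d R. ae_eq d f (\<lambda>_. 0) \<longrightarrow> ae_eq d (?A f) (\<lambda>_. 0)"
  proof (intro ballI impI)
    fix f assume "f \<in> sobolev d R" "ae_eq d f (\<lambda>_. 0)"
    then have "AE x in torus d. f x * cnj (fourier_char d k x) = 0" for k
      by (auto simp: ae_eq_def)
    then have "torus.coeff d f k = 0" for k
      unfolding torus.coeff_def by (rule integral_eq_zero_AE)
    then show "ae_eq d (?A f) (\<lambda>_. 0)"
      by (simp add: ae_eq_def)
  qed
  moreover have "\<exists>B. \<forall>f\<in>sobolev d R. L2_norm d (?A f) \<le> B * sobolev_norm d R f"
  proof (intro exI[of _ 1] ballI)
    fix f assume f: "f \<in> sobolev d R"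
    have "(L2_norm d (?A f))\<^sup>2 = (\<Sum>k\<in>F. (cmod (torus.coeff d f k))\<^sup>2)"
      unfolding L2_norm_sq by (rule s(2))
    also have "\<dots> \<le> (\<Sum>k\<in>F. sob_weight d R k * (cmod (torus.coeff d f k))\<^sup>2)"
      by (intro sum_mono coeff_sq_le_weighted)
    also have "\<dots> \<le> (sobolev_norm d R f)\<^sup>2"
      unfolding sobolev_norm_sq fourier_coeff_eq_coeff
      using order_trans[OF zero_le_one sob_weight_ge_1]
      by (intro finite_sum_le_infsum sobolev_D(3) f F mult_nonneg_nonneg) auto
    finally show "L2_norm d (?A f) \<le> 1 * sobolev_norm d R f"
      by (simp add: power2_le_imp_le[OF _ sobolev_norm_nonneg])
  qed
  moreover have "\<exists>G. finite G \<and> card G < n \<and> G \<subseteq> L2 d \<and>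
      (\<forall>f\<in>sobolev d R. \<exists>c. ae_eq d (?A f) (\<lambda>x. \<Sum>g\<in>G. c g * g x))"
  proof (intro exI[of _ "fourier_char d ` F"] conjI ballI)
    show "card (fourier_char d ` F) < n"
      using F card_image_le le_less_trans by blast
    show "fourier_char d ` F \<subseteq> L2 d"
      using torus.square_integrable_sum(1)[of "{k}" d "\<lambda>_. 1" for k] F
      by (auto simp: L2_iff_square_integrable)
    fix f assume "f \<in> sobolev d R"
    \<comment> \<open>The spanning set in \<open>admissible\<close> consists of functions, so the
      coefficients are transported from frequencies to characters.\<close>
    have inj: "inj_on (fourier_char d) F"
      using torus.inj_on_basis F(2) by (rule inj_on_subset)
    have "?A f = (\<lambda>x. \<Sum>g\<in>fourier_char d ` F. torus.coeff d f (inv_into F (fourier_char d) g) * g x)"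
      by (intro ext) (simp add: sum.reindex[OF inj] inj)
    then show "\<exists>c. ae_eq d (?A f) (\<lambda>x. \<Sum>g\<in>fourier_char d ` F. c g * g x)"
      by (auto simp: ae_eq_def)
  qed (use F in auto)
  ultimately show ?thesis
    unfolding admissible_def by blast
qed

text \<open>The remainder of the truncation to \<open>F\<close> has no coefficients on
  \<open>F\<close>, and elsewhere the weight is at least \<open>W\<close>, so its squared L2 norm is
  at most 1/W times the squared Sobolev norm.\<close>

lemma approx_num_le:
  assumes F: "finite F" "F \<subseteq> lattice d" "card F < n"
    and W: "0 < W" "\<And>k. k \<in> lattice d - F \<Longrightarrow> W \<le> sob_weight d R k"
  shows "approx_num d R n \<le> 1 / sqrt W"
proof -
  let ?A = "\<lambda>f x. \<Sum>k\<in>F. torus.coeff d f k * fourier_char d k x"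
  have A: "admissible d R n ?A"
    by (rule admissible_partial_sum[OF F])
  have "approx_num d R n \<le> op_dist d R ?A"
    unfolding approx_num_def
  proof (rule cInf_lower)
    \<comment> \<open>Each \<open>op_dist\<close> is a supremum over a set that contains the
      nonnegative value at the zero function.\<close>
    show "bdd_below {op_dist d R A |A. admissible d R n A}"
    proof (rule bdd_belowI)
      fix y assume "y \<in> {op_dist d R A |A. admissible d R n A}"
      then obtain A where "admissible d R n A" "y = op_dist d R A"
        by auto
      then have "L2_norm d (\<lambda>x. 0 - A (\<lambda>_. 0) x) \<le> y"
        using op_dist_ge[OF _ zero_in_sobolev, of d R n A] by (simp add: sobolev_norm_zero)
      then show "0 \<le> y"
        by (rule order_trans[OF L2_norm_nonneg])
    qed
  qed (use A in blast)
  also have "\<dots> \<le> 1 / sqrt W"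
    unfolding op_dist_def
  proof (rule cSup_least)
    show "{L2_norm d (\<lambda>x. f x - ?A f x) |f. f \<in> sobolev d R \<and> sobolev_norm d R f \<le> 1} \<noteq> {}"
      using zero_in_sobolev sobolev_norm_zero by (metis (mono_tags, lifting) empty_Collect_eq zero_le_one)
    fix y assume "y \<in> {L2_norm d (\<lambda>x. f x - ?A f x) |f. f \<in> sobolev d R \<and> sobolev_norm d R f \<le> 1}"
    then obtain f where f: "f \<in> sobolev d R" "sobolev_norm d R f \<le> 1" and y: "y = L2_norm d (\<lambda>x. f x - ?A f x)"
      by auto
    let ?w = "\<lambda>k. sob_weight d R k * (cmod (torus.coeff d f k))\<^sup>2"
    have "y\<^sup>2 \<le> (\<Sum>\<^sub>\<infinity>k\<in>lattice d. 1 / W * ?w k)"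
      unfolding y
    proof (rule L2_norm_sq_le)
      show "(\<lambda>x. f x - ?A f x) \<in> L2 d"
        using torus.square_integrable_diff_sum(1)[OF sobolev_D(2)[OF f(1)] F(1,2), of "torus.coeff d f"]
        by (simp add: L2_iff_square_integrable)
      show "(\<lambda>k. 1 / W * ?w k) summable_on lattice d"
        by (intro summable_on_cmult_right sobolev_D(3) f)
      fix k assume k: "k \<in> lattice d"
      show "(cmod (fourier_coeff d (\<lambda>x. f x - ?A f x) k))\<^sup>2 \<le> 1 / W * ?w k"
      proof (cases "k \<in> F")
        case True
        then show ?thesis
          using k W sob_weight_ge_1[of d R k]
          by (simp add: fourier_coeff_eq_coeff torus.coeff_diff_sum[OF sobolev_D(2)[OF f(1)] F(1,2) k])
      next
        case False
        then have "1 * (cmod (torus.coeff d f k))\<^sup>2 \<le> sob_weight d R k / W * (cmod (torus.coeff d f k))\<^sup>2"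
          using W k by (intro mult_right_mono) auto
        then show ?thesis
          using False by (simp add: fourier_coeff_eq_coeff torus.coeff_diff_sum[OF sobolev_D(2)[OF f(1)] F(1,2) k])
      qed
    qed
    also have "\<dots> = 1 / W * (sobolev_norm d R f)\<^sup>2"
      unfolding sobolev_norm_sq fourier_coeff_eq_coeff by (rule infsum_cmult_right')
    also have "\<dots> \<le> 1 / W * 1"
      using f(2) W sobolev_norm_nonneg by (intro mult_left_mono power_le_one) auto
    finally have "y \<le> sqrt (1 / W)"
      by (intro real_le_rsqrt) simp
    then show "y \<le> 1 / sqrt W"
      by (simp add: real_sqrt_divide)
  qed
  finally show ?thesis .
qed

subsection \<open>Bounds in the three ranges\<close>

text \<open>Frequencies with support \<open>S\<close> of size \<open>s\<close> and entries 1 on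
  \<open>T\<close>, -1 on \<open>S - T\<close>. Each has weight exactly \<open>1 + s\<close> for
  every \<open>R\<close>, as powers of 1 are 1.\<close>

lemma approx_num_ge_sparse:
  assumes n: "n \<ge> 1" "n \<le> (d choose s) * 2 ^ s"
  shows "1 / sqrt (1 + real s) \<le> approx_num d R n"
proof -
  let ?X = "SIGMA S:{S. S \<subseteq> {..<d} \<and> card S = s}. Pow S"
  let ?k = "\<lambda>(S, T) j. if j \<in> T then 1 else if j \<in> S then -1 else (0::int)"
  have fin: "finite {S. S \<subseteq> {..<d} \<and> card S = s}"
    by (rule finite_subset[of _ "Pow {..<d}"]) auto
  have "inj_on ?k ?X"
  proof (rule inj_onI, clarify)
    fix S T S' T' assume sub: "T \<subseteq> S" "T' \<subseteq> S'"
      and eq: "(\<lambda>j. if j \<in> T then 1 else if j \<in> S then -1 else 0::int)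
        = (\<lambda>j. if j \<in> T' then 1 else if j \<in> S' then -1 else 0)"
    have "j \<in> S \<longleftrightarrow> j \<in> S'" "j \<in> T \<longleftrightarrow> j \<in> T'" for j
      using fun_cong[OF eq, of j] sub by (auto split: if_splits)
    then show "S = S' \<and> T = T'"
      by blast
  qed
  then have "card (?k ` ?X) = card ?X"
    by (rule card_image)
  also have "\<dots> = (\<Sum>S | S \<subseteq> {..<d} \<and> card S = s. card (Pow S))"
    using fin by (intro card_SigmaI) (auto intro: finite_subset[of _ "{..<d}"])
  also have "\<dots> = (\<Sum>S | S \<subseteq> {..<d} \<and> card S = s. 2 ^ s)"
    by (intro sum.cong) (auto simp: card_Pow[OF finite_subset[OF _ finite_lessThan]])
  also have "\<dots> = (d choose s) * 2 ^ s"
    using n_subsets[of "{..<d}" s] by simp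
  finally have card: "card (?k ` ?X) = (d choose s) * 2 ^ s" .
  show ?thesis
  proof (rule approx_num_ge)
    show "finite (?k ` ?X)"
      using fin by (intro finite_imageI finite_SigmaI) (auto intro: finite_subset[of _ "{..<d}"])
    show "?k ` ?X \<subseteq> lattice d"
      by (fastforce simp: lattice_def)
    show "n \<le> card (?k ` ?X)"
      using n card by simp
    fix k assume "k \<in> ?k ` ?X"
    then obtain S T where ST: "S \<subseteq> {..<d}" "card S = s" "T \<subseteq> S" and k: "k = ?k (S, T)"
      by auto
    have "(\<Sum>j<d. \<bar>real_of_int (k j)\<bar> powr (2 * R j)) = (\<Sum>j<d. if j \<in> S then 1 else 0)"
      using ST by (intro sum.cong) (auto simp: k)
    also have "\<dots> = real (card S)"
      using ST by (simp add: sum.If_cases Int_absorb1)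
    finally show "sob_weight d R k \<le> 1 + real s"
      using ST by (simp add: sob_weight_def)
  qed (use n in auto)
qed

lemma approx_num_ge_box:
  assumes R: "\<And>j. j < d \<Longrightarrow> 0 < R j" and n: "n \<ge> 1" "n \<le> (\<Prod>j<d. 2 * b j + 1)"
    and W: "1 + (\<Sum>j<d. real (b j) powr (2 * R j)) \<le> W"
  shows "1 / sqrt W \<le> approx_num d R n"
proof (rule approx_num_ge)
  let ?K = "{k \<in> lattice d. \<forall>j<d. \<bar>k j\<bar> \<le> int (b j)}"
  show "finite ?K" "n \<le> card ?K"
    using finite_lattice_box card_lattice_box n by auto
  show "0 < W"
    using W sum_nonneg[of "{..<d}" "\<lambda>j. real (b j) powr (2 * R j)"] by auto
  fix k assume k: "k \<in> ?K"
  have "(\<Sum>j<d. \<bar>real_of_int (k j)\<bar> powr (2 * R j)) \<le> (\<Sum>j<d. real (b j) powr (2 * R j))"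
  proof (rule sum_mono)
    fix j assume "j \<in> {..<d}"
    then have "\<bar>k j\<bar> \<le> int (b j)" "0 < R j"
      using k R by auto
    then show "\<bar>real_of_int (k j)\<bar> powr (2 * R j) \<le> real (b j) powr (2 * R j)"
      by (intro powr_mono2) linarith+
  qed
  then show "sob_weight d R k \<le> W"
    using W by (simp add: sob_weight_def)
qed (use n in auto)

lemma approx_num_ge_cube:
  assumes "\<And>j. j < d \<Longrightarrow> 0 < R j" "n \<ge> 1" "n \<le> 3 ^ d"
  shows "1 / sqrt (1 + real d) \<le> approx_num d R n"
  using assms by (intro approx_num_ge_box[where b = "\<lambda>_. 1"]) auto

text \<open>Truncation to the sublevel set itself: outside it the weight exceeds
  \<open>1 + t\<close>. Weakening this to \<open>t\<close> keeps the later choices of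
  \<open>t\<close> simple.\<close>

lemma approx_num_le_count:
  assumes "\<And>j. j < d \<Longrightarrow> 0 < R j" "0 < t"
    and "card {k \<in> lattice d. sob_weight d R k \<le> 1 + t} < n"
  shows "approx_num d R n \<le> 1 / sqrt t"
proof -
  have "approx_num d R n \<le> 1 / sqrt (1 + t)"
    by (rule approx_num_le[where F = "{k \<in> lattice d. sob_weight d R k \<le> 1 + t}"])
       (use assms finite_sublevel in auto)
  also have "\<dots> \<le> 1 / sqrt t"
    using assms by (intro divide_left_mono) auto
  finally show ?thesis .
qed

text \<open>Bernoulli's inequality in logarithmic form. It follows from concavity:
  \<open>1 + y\<close> is the mean of \<open>1 + r * y\<close> and 1 with weights
  \<open>1 / r\<close> and \<open>1 - 1 / r\<close>, and the tangent of the logarithm at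
  \<open>1 + y\<close> is used at both points.\<close>

lemma ln_one_plus_mult_le:
  fixes r y :: real
  assumes "1 \<le> r" "0 \<le> y"
  shows "ln (1 + r * y) \<le> r * ln (1 + y)"
proof -
  define w where "w = 1 / r"
  have w: "0 \<le> w" "w \<le> 1" "w * r = 1"
    using assms by (auto simp: w_def)
  have y: "1 + y > 0" "1 + r * y > 0"
    using assms by (auto intro: add_pos_nonneg)
  have 1: "ln (1 + r * y) - ln (1 + y) \<le> (1 + r * y) / (1 + y) - 1"
    using ln_le_minus_one[of "(1 + r * y) / (1 + y)"] y by (simp add: ln_div)
  have 2: "- ln (1 + y) \<le> 1 / (1 + y) - 1"
    using ln_le_minus_one[of "1 / (1 + y)"] y by (simp add: ln_div)
  have "w * (ln (1 + r * y) - ln (1 + y)) + (1 - w) * (- ln (1 + y))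
      \<le> w * ((1 + r * y) / (1 + y) - 1) + (1 - w) * (1 / (1 + y) - 1)"
    using w 1 2 by (intro add_mono mult_left_mono) auto
  also have "\<dots> = (1 + (w * r) * y) / (1 + y) - 1"
    by (simp add: divide_simps) (simp add: algebra_simps)
  also have "\<dots> = 0"
    using y w by simp
  finally have "w * ln (1 + r * y) \<le> ln (1 + y)"
    by (simp add: algebra_simps)
  then have "r * (w * ln (1 + r * y)) \<le> r * ln (1 + y)"
    using assms by (intro mult_left_mono) auto
  then show ?thesis
    using w by (simp add: mult.assoc[symmetric] mult.commute[of r])
qed

text \<open>Here \<open>x\<close> is the inverse square of the claimed rate and \<open>s\<close> its
  ceiling. Sparse vectors number at least (2d/s)^s \<ge> (1+d/s)^s, and s ln(1+d/s) \<ge> x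
  ln(1+d/x) \<ge> x ln(1+d/L) = ln n, the first step by Bernoulli. If \<open>s \<ge> d\<close>, the
  cube with entries -1, 0, 1 suffices.\<close>

lemma approx_num_lower_middle:
  assumes R: "\<And>j. j < d \<Longrightarrow> 0 < R j" and d: "d \<ge> 1" and n: "d \<le> n" "n \<le> 3 ^ d" "2 \<le> n"
  shows "1 / sqrt 5 * sqrt (log 2 (1 + real d / log 2 (real n)) / log 2 (real n)) \<le> approx_num d R n"
proof -
  define L where "L = log 2 (real n)"
  define l where "l = log 2 (1 + real d / L)"
  define x where "x = L / l"
  define s where "s = nat \<lceil>x\<rceil>"
  have L: "L \<ge> 1"
    using n by (simp add: L_def le_log_iff)
  have pos: "real d / L > 0"
    using L d by simp
  then have l: "l > 0"
    unfolding l_def by (subst zero_less_log_cancel_iff) auto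
  have x: "x > 0"
    using L l by (simp add: x_def)
  \<comment> \<open>Gives \<open>x \<ge> 1 / 2\<close>, so that rounding up costs only a constant: 1
    + s < x + 2 \<le> 5 x.\<close>
  have "l \<le> 2 * L"
  proof -
    have "real d / L \<le> real d / 1"
      using L by (intro divide_left_mono) auto
    also have "\<dots> \<le> real n"
      using n by simp
    finally have "1 + real d / L \<le> 2 * real n"
      using n by simp
    then have "l \<le> log 2 (2 * real n)"
      unfolding l_def using pos n by (subst log_le_cancel_iff) auto
    also have "\<dots> = 1 + L"
      using n by (simp add: log_mult L_def)
    finally show ?thesis
      using L by simp
  qed
  then have "x \<ge> 1 / 2"
    using l by (simp add: x_def field_simps)
  moreover have "real s < x + 1" "x \<le> real s"
    using x unfolding s_def by linarith+
  ultimately have s: "1 + real s \<le> 5 * x" "x \<le> real s"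
    by linarith+
  have "1 / sqrt (5 * x) \<le> approx_num d R n"
  proof (cases "s \<ge> d")
    case True
    have "1 / sqrt (5 * x) \<le> 1 / sqrt (1 + real d)"
      using s True by (intro divide_left_mono) auto
    also have "\<dots> \<le> approx_num d R n"
      using R n by (intro approx_num_ge_cube) auto
    finally show ?thesis .
  next
    case False
    then have sd: "s < d" and s0: "real s > 0"
      using s x by auto
    \<comment> \<open>Otherwise \<open>l < 1\<close>, which means d < L < x \<le> s, against
      \<open>s < d\<close>.\<close>
    have "x \<le> L"
    proof (rule ccontr)
      assume *: "\<not> x \<le> L"
      then have "l < 1"
        using l L by (simp add: x_def field_simps)
      then have "real d / L < 1"
        using L by (simp add: l_def log_less_iff add_pos_nonneg)
      then have "real d < L"
        using L by (simp add: field_simps)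
      then show False
        using * s sd by linarith
    qed
    have "ln (real n) = L * ln 2"
      by (simp add: L_def log_def)
    also have "\<dots> = x * ln (1 + real d / L)"
      using l by (simp add: x_def l_def log_def field_simps)
    also have "\<dots> \<le> x * ln (1 + real d / x)"
    proof (rule mult_left_mono)
      have "real d / L \<le> real d / x"
        using x \<open>x \<le> L\<close> by (intro divide_left_mono) auto
      then show "ln (1 + real d / L) \<le> ln (1 + real d / x)"
        using pos by (subst ln_le_cancel_iff) auto
    qed (use x in simp)
    also have "real d / x = (s / x) * (d / s)"
      using s0 by simp
    also have "x * ln (1 + (s / x) * (d / s)) \<le> x * ((s / x) * ln (1 + d / s))"
      using x s by (intro mult_left_mono ln_one_plus_mult_le) auto
    also have "\<dots> = s * ln (1 + d / s)"
      using x by simp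
    also have "\<dots> = ln ((1 + d / s) ^ s)"
      using s0 by (subst ln_realpow) (auto intro: add_pos_nonneg)
    finally have "real n \<le> (1 + d / s) ^ s"
      using n by (subst (asm) ln_le_cancel_iff) (auto intro!: zero_less_power add_pos_nonneg)
    also have "\<dots> \<le> (d / s * 2) ^ s"
      using s0 sd by (intro power_mono) (auto simp: field_simps)
    also have "\<dots> = (d / s) ^ s * 2 ^ s"
      by (rule power_mult_distrib)
    also have "\<dots> \<le> real (d choose s) * 2 ^ s"
      using binomial_ge_n_over_k_pow_k[of s d] sd by (intro mult_right_mono) auto
    finally have "real n \<le> real ((d choose s) * 2 ^ s)"
      by simp
    then have "n \<le> (d choose s) * 2 ^ s"
      by (simp only: of_nat_le_iff)
    then have "1 / sqrt (1 + real s) \<le> approx_num d R n"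
      using n by (intro approx_num_ge_sparse) auto
    moreover have "1 / sqrt (5 * x) \<le> 1 / sqrt (1 + real s)"
      using s by (intro divide_left_mono) auto
    ultimately show ?thesis
      by linarith
  qed
  moreover have "1 / sqrt (5 * x) = 1 / sqrt 5 * sqrt (l / L)"
    by (simp add: x_def real_sqrt_mult real_sqrt_divide)
  ultimately show ?thesis
    by (simp add: l_def L_def)
qed

text \<open>The half-sides are the integer parts of n^(g/R_j). The exponents g/R_j sum to 1 and 2
  floor(y) + 1 \<ge> y, so the box has at least \<open>n\<close> points, while every coordinate adds
  at most n^(2g) to the weight.\<close>

lemma approx_num_lower_large:
  fixes R :: "nat \<Rightarrow> real"
  assumes R: "\<And>j. j < d \<Longrightarrow> 0 < R j" and d: "d \<ge> 1" and n: "n \<ge> 1"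
  defines "g \<equiv> 1 / (\<Sum>j<d. 1 / R j)"
  shows "1 / sqrt 2 * (real d powr (-1/2) * real n powr (- g)) \<le> approx_num d R n"
proof -
  define b where "b j = nat \<lfloor>real n powr (g / R j)\<rfloor>" for j
  have sum_pos: "(\<Sum>j<d. 1 / R j) > 0"
    using R d by (intro sum_pos) (auto simp: lessThan_empty_iff)
  then have g: "g > 0" "(\<Sum>j<d. g / R j) = 1"
    by (auto simp: g_def sum_divide_distrib[symmetric] divide_inverse sum_distrib_left[symmetric])
  have b: "real (b j) \<le> real n powr (g / R j)" "real n powr (g / R j) \<le> real (2 * b j + 1)" for j
    using powr_ge_zero[of "real n" "g / R j"] unfolding b_def by linarith+
  have "real n = real n powr (\<Sum>j<d. g / R j)"
    using g n by simp
  also have "\<dots> = (\<Prod>j<d. real n powr (g / R j))"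
    using n by (intro powr_sum) auto
  also have "\<dots> \<le> (\<Prod>j<d. real (2 * b j + 1))"
    using b by (intro prod_mono) auto
  also have "\<dots> = real (\<Prod>j<d. 2 * b j + 1)"
    by (simp only: of_nat_prod)
  finally have "n \<le> (\<Prod>j<d. 2 * b j + 1)"
    by (simp only: of_nat_le_iff)
  moreover have "1 + (\<Sum>j<d. real (b j) powr (2 * R j)) \<le> 2 * (real d * real n powr (2 * g))"
  proof -
    have "(\<Sum>j<d. real (b j) powr (2 * R j)) \<le> (\<Sum>j<d. real n powr (2 * g))"
    proof (rule sum_mono)
      fix j assume "j \<in> {..<d}"
      then have Rj: "0 < R j"
        using R by simp
      then have "real (b j) powr (2 * R j) \<le> (real n powr (g / R j)) powr (2 * R j)"
        using b by (intro powr_mono2) auto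
      also have "\<dots> = real n powr (2 * g)"
        using Rj by (simp add: powr_powr mult.commute)
      finally show "real (b j) powr (2 * R j) \<le> real n powr (2 * g)" .
    qed
    moreover have "1 * 1 \<le> real d * real n powr (2 * g)"
      using d n g by (intro mult_mono ge_one_powr_ge_zero) auto
    ultimately show ?thesis
      by simp
  qed
  ultimately have "1 / sqrt (2 * (real d * real n powr (2 * g))) \<le> approx_num d R n"
    using R n by (intro approx_num_ge_box) auto
  moreover have "sqrt (real n powr (2 * g)) = real n powr g"
    using n by (intro real_sqrt_unique) (auto simp: powr_powr[symmetric] powr_add[symmetric] power2_eq_square)
  ultimately show ?thesis
    using d by (simp add: real_sqrt_mult powr_minus powr_half_sqrt field_simps)
qed

section \<open>Upper bounds from the count of sublevel sets\<close>

lemma ln_le_half: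
  fixes y :: real
  assumes "y > 0"
  shows "ln y \<le> y / 2"
  using ln_le_minus_one[of "y / 2"] assms ln_2_less_1 by (simp add: ln_div)

text \<open>The threshold \<open>t\<close> is a small multiple of the inverse squared rate
  \<open>L / l\<close>. Since \<open>ln (d / t)\<close> is at most \<open>2 * l + 16 * D\<close>,
  the exponent in the count is a small multiple of \<open>L\<close> and stays below
  \<open>ln n\<close>.\<close>

lemma approx_num_upper_middle:
  fixes R :: "nat \<Rightarrow> real"
  assumes R: "\<And>j. j < d \<Longrightarrow> 0 < R j" and d: "d \<ge> 1" and n: "d \<le> n" "n \<le> 3 ^ d" "2 \<le> n"
    and D: "D \<ge> 9" and count: "\<And>t. \<lbrakk>0 < t; t \<le> real d\<rbrakk> \<Longrightarrow>
       real (card {k \<in> lattice d. sob_weight d R k \<le> 1 + t}) \<le> exp (t * (D + ln (d / t)))"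
  shows "approx_num d R n \<le> 8 * D * sqrt (log 2 (1 + real d / log 2 (real n)) / log 2 (real n))"
proof -
  define L where "L = log 2 (real n)"
  define l where "l = log 2 (1 + real d / L)"
  \<comment> \<open>Small enough for \<open>c * (34 * D + 2) \<le> 1 / 16\<close>; its root produces
    the factor \<open>8 * D\<close> of the claim.\<close>
  define c where "c = 1 / (64 * D\<^sup>2)"
  define t where "t = c * (L / l)"
  have L: "L \<ge> 1"
    using n by (simp add: L_def le_log_iff)
  \<comment> \<open>This keeps \<open>l\<close> above 1/2, hence \<open>L / l \<le> 2 * L\<close>,
    and it places \<open>t\<close> in the range \<open>t \<le> d\<close> of the count.\<close>
  have "L \<le> 2 * d"
  proof -
    have "real n \<le> 3 ^ d"
      using n(2) by (metis of_nat_le_iff of_nat_power of_nat_numeral)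
    also have "(3::real) ^ d \<le> 4 ^ d"
      by (intro power_mono) auto
    also have "\<dots> = 2 powr (2 * d)"
      by (simp add: powr_realpow[symmetric] powr_powr[symmetric])
    finally show ?thesis
      using n by (simp add: L_def log_le_iff)
  qed
  then have "1 + d / L \<ge> 3 / 2"
    using L by (simp add: field_simps)
  have l: "l \<ge> 1 / 2"
  proof -
    have "sqrt 2 \<le> sqrt ((3/2)\<^sup>2)"
      by (intro real_sqrt_le_mono) (simp add: power2_eq_square)
    also have "\<dots> \<le> 1 + d / L"
      using \<open>1 + d / L \<ge> 3 / 2\<close> by simp
    finally show ?thesis
      unfolding l_def using L by (subst le_log_iff) (auto simp: powr_half_sqrt intro: add_pos_nonneg)
  qed
  have c: "c > 0" "c \<le> 1 / 4" "c * (34 * D + 2) \<le> 1 / 16"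
  proof -
    obtain P where P: "P = D\<^sup>2"
      by blast
    have "9 * D \<le> P"
      using mult_right_mono[OF D, of D] D by (simp add: P power2_eq_square)
    then show "c > 0" "c \<le> 1 / 4" "c * (34 * D + 2) \<le> 1 / 16"
      using D unfolding c_def P[symmetric] by (auto simp: field_simps)
  qed
  have "L / l \<le> L / (1 / 2)"
    using L l by (intro divide_left_mono) auto
  then have Ll: "L / l \<le> 2 * L" "L / l > 0"
    using L l by auto
  have t: "t > 0"
    using c L l by (simp add: t_def)
  have "t \<le> 1 / 4 * (2 * L)"
    unfolding t_def using c Ll by (intro mult_mono) auto
  then have "t \<le> d"
    using \<open>L \<le> 2 * d\<close> by simp
  have "d / t \<le> (1 + d / L) ^ 2 * (8 * D) ^ 2"
  proof -
    have "l \<le> 1 + d / L"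
    proof -
      have "ln (1 + d / L) \<le> (1 + d / L) / 2"
        using L by (intro ln_le_half) (auto intro: add_pos_nonneg)
      also have "\<dots> = (1 + d / L) * (1 / 2)"
        by simp
      also have "\<dots> \<le> (1 + d / L) * ln 2"
        using ln2_ge_two_thirds L by (intro mult_left_mono) (auto intro: add_nonneg_nonneg)
      finally show ?thesis
        by (simp add: l_def log_def divide_le_eq)
    qed
    then have "(d / L) * l \<le> (1 + d / L) * (1 + d / L)"
      using L l by (intro mult_mono) auto
    then have "(d / L) * l * (64 * D\<^sup>2) \<le> (1 + d / L) * (1 + d / L) * (64 * D\<^sup>2)"
      by (intro mult_right_mono) auto
    then show ?thesis
      using L l D by (simp add: t_def c_def power2_eq_square field_simps)
  qed
  then have "ln (d / t) \<le> ln ((1 + d / L) ^ 2 * (8 * D) ^ 2)"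
    using d t D L by (subst ln_le_cancel_iff) (auto intro!: mult_pos_pos zero_less_power add_pos_nonneg)
  also have "\<dots> = 2 * ln (1 + d / L) + 2 * ln (8 * D)"
  proof -
    have "1 + d / L > 0" "8 * D > 0"
      using D L by (auto intro: add_pos_nonneg)
    then show ?thesis
      by (simp only: ln_mult_pos ln_realpow zero_less_power of_nat_numeral)
  qed
  also have "ln (1 + d / L) = l * ln 2"
    by (simp add: l_def log_def)
  also have "l * ln 2 \<le> l * 1"
    using l ln_2_less_1 by (intro mult_left_mono) auto
  also have "ln (8 * D) \<le> 8 * D"
    using ln_le_minus_one[of "8 * D"] D by simp
  finally have ln: "ln (d / t) \<le> 2 * l + 16 * D"
    by simp
  \<comment> \<open>The part \<open>2 * l\<close> cancels the denominator of \<open>t\<close>; for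
    the part with \<open>D\<close> the bound \<open>L / l \<le> 2 * L\<close> suffices.\<close>
  have "t * (D + ln (d / t)) \<le> t * (2 * l + 17 * D)"
    using t ln by (intro mult_left_mono) auto
  also have "\<dots> = 2 * c * L + 17 * D * c * (L / l)"
    using l by (simp add: t_def field_simps)
  also have "\<dots> \<le> 2 * c * L + 17 * D * c * (2 * L)"
    using Ll c D by (intro add_left_mono mult_left_mono) auto
  also have "\<dots> = c * (34 * D + 2) * L"
    by (simp add: algebra_simps)
  also have "\<dots> \<le> 1 / 16 * L"
    using c L by (intro mult_right_mono) auto
  also have "\<dots> < ln 2 * L"
    using ln2_ge_two_thirds L by (intro mult_strict_right_mono) auto
  also have "\<dots> = ln (real n)"
    by (simp add: L_def log_def)
  finally have "exp (t * (D + ln (d / t))) < real n"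
    using n by (metis exp_less_cancel_iff exp_ln of_nat_0_less_iff less_le_trans zero_less_numeral)
  then have "card {k \<in> lattice d. sob_weight d R k \<le> 1 + t} < n"
    using count[OF t \<open>t \<le> d\<close>] by linarith
  then have "approx_num d R n \<le> 1 / sqrt t"
    using R t by (intro approx_num_le_count) auto
  also have "1 / sqrt t = 8 * D * sqrt (l / L)"
    using D by (simp add: t_def c_def real_sqrt_mult real_sqrt_divide)
  finally show ?thesis
    by (simp add: l_def L_def)
qed

text \<open>If the threshold c d n^(2g) reaches \<open>d\<close>, the second count applies to it.
  Otherwise n^g is bounded by a power of \<open>E\<close>, the rate is comparable to d^(-1/2), and a
  small multiple of \<open>d\<close> serves as threshold through the first count and exp(d) \<le>
  3^d \<le> n.\<close>

lemma approx_num_upper_large: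
  fixes R :: "nat \<Rightarrow> real"
  assumes R: "\<And>j. j < d \<Longrightarrow> 0 < R j \<and> R j \<le> u" and d: "d \<ge> 1" and n: "3 ^ d \<le> n"
    and D: "D \<ge> 9"
    and count1: "\<And>t. \<lbrakk>0 < t; t \<le> real d\<rbrakk> \<Longrightarrow>
       real (card {k \<in> lattice d. sob_weight d R k \<le> 1 + t}) \<le> exp (t * (D + ln (d / t)))"
    and count2: "\<And>t. \<lbrakk>0 < t; real d \<le> t\<rbrakk> \<Longrightarrow>
       real (card {k \<in> lattice d. sob_weight d R k \<le> 1 + t})
         \<le> (exp 1 * D) ^ d * (t / d) powr (\<Sum>j<d. 1 / (2 * R j))"
  defines "g \<equiv> 1 / (\<Sum>j<d. 1 / R j)"
  shows "approx_num d R n \<le> 2 * D * (2 * exp 1 * D) powr u * (real d powr (-1/2) * real n powr (- g))"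
proof -
  \<comment> \<open>The factor 2 beyond \<open>exp 1 * D\<close> brings the count down to n / 2^d,
    strictly below \<open>n\<close>.\<close>
  define E where "E = 2 * exp 1 * D"
  define c where "c = E powr (- 2 * u)"
  have "E \<ge> 2 * 1 * 1"
    unfolding E_def using D by (intro mult_mono) auto
  then have E: "E \<ge> 1"
    by simp
  have n0: "n \<ge> 1"
    using n by (metis one_le_numeral one_le_power order_trans)
  have sum_pos: "(\<Sum>j<d. 1 / R j) > 0"
    using R d by (intro sum_pos) (auto simp: lessThan_empty_iff)
  then have g: "g > 0"
    by (simp add: g_def)
  have q: "(\<Sum>j<d. 1 / (2 * R j)) = 1 / (2 * g)"
    by (simp add: g_def sum_divide_distrib mult.commute)
  have c: "c > 0"
    using E by (simp add: c_def)
  have sqrt_c: "sqrt c = E powr (- u)"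
    using E by (intro real_sqrt_unique) (auto simp: c_def powr_add[symmetric] power2_eq_square)
  have sqrt_n: "sqrt (real n powr (2 * g)) = real n powr g"
    by (intro real_sqrt_unique) (auto simp: powr_add[symmetric] power2_eq_square)
  have d_half: "real d powr (-1/2) = 1 / sqrt d"
    using d by (simp add: powr_minus powr_half_sqrt field_simps)
  show ?thesis
  proof (cases "c * real n powr (2 * g) \<ge> 1")
    case True
    define t where "t = c * d * real n powr (2 * g)"
    have td: "t / d = c * real n powr (2 * g)"
      using d by (simp add: t_def)
    have t: "0 < t" "real d \<le> t"
      using c d n0 mult_left_mono[OF True, of "real d"] by (auto simp: t_def mult_ac)
    have "real (card {k \<in> lattice d. sob_weight d R k \<le> 1 + t})
        \<le> (exp 1 * D) ^ d * (c * real n powr (2 * g)) powr (1 / (2 * g))"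
      using count2[OF t] by (simp add: td q)
    also have "(c * real n powr (2 * g)) powr (1 / (2 * g)) = c powr (1 / (2 * g)) * real n"
      using c g n0 by (simp add: powr_mult powr_powr)
    \<comment> \<open>This tames the constants that enter as \<open>d\<close>-th powers:
      \<open>R j \<le> u\<close> gives d \<le> u/g, so the root of \<open>c\<close> is small enough
      to absorb them.\<close>
    also have "c powr (1 / (2 * g)) \<le> E powr (- d)"
    proof -
      have "real d = (\<Sum>j<d. 1)"
        by simp
      also have "\<dots> \<le> (\<Sum>j<d. u * (1 / R j))"
        using R by (intro sum_mono) (simp add: field_simps)
      also have "\<dots> = u * (1 / g)"
        by (simp add: g_def sum_distrib_left)
      finally show ?thesis
        using E g unfolding c_def powr_powr by (intro powr_mono) (auto simp: field_simps)
    qed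
    also have "E powr (- d) = 1 / E ^ d"
      using E by (simp add: powr_minus powr_realpow divide_inverse)
    also have "(exp 1 * D) ^ d * (1 / E ^ d * real n) = real n / 2 ^ d"
      using D by (simp add: E_def power_mult_distrib field_simps)
    also have "\<dots> < real n / 1"
      using n0 d by (intro divide_strict_left_mono) auto
    finally have "card {k \<in> lattice d. sob_weight d R k \<le> 1 + t} < n"
      using D by (simp add: mult_left_mono mult_right_mono)
    then have "approx_num d R n \<le> 1 / sqrt t"
      using R t by (intro approx_num_le_count) auto
    also have "1 / sqrt t = E powr u * (real d powr (-1/2) * real n powr (- g))"
      unfolding d_half by (simp add: t_def real_sqrt_mult sqrt_c sqrt_n powr_minus divide_inverse)
    also have "\<dots> = 1 * (E powr u * (real d powr (-1/2) * real n powr (- g)))"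
      by simp
    also have "\<dots> \<le> (2 * D) * (E powr u * (real d powr (-1/2) * real n powr (- g)))"
      using D by (intro mult_right_mono) auto
    finally show ?thesis
      by (simp add: E_def mult_ac)
  next
    case False
    \<comment> \<open>As ln((2D)^2) \<le> 4D, the exponent of the count is at most 5 D
      \<open>\<tau>\<close> d, which is below \<open>d\<close>; the root of \<open>\<tau>\<close>
      contributes \<open>2 * D\<close>.\<close>
    define \<tau> where "\<tau> = 1 / (2 * D)\<^sup>2"
    have \<tau>: "0 < \<tau>" "\<tau> * (5 * D) < 1" "\<tau> \<le> 1"
    proof -
      obtain P where P: "P = D\<^sup>2"
        by blast
      have "9 * D \<le> P"
        using mult_right_mono[OF D, of D] D by (simp add: P power2_eq_square)
      then show "0 < \<tau>" "\<tau> * (5 * D) < 1" "\<tau> \<le> 1"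
        using D unfolding \<tau>_def power_mult_distrib P[symmetric] by (auto simp: field_simps)
    qed
    have t: "0 < \<tau> * d" "\<tau> * d \<le> d"
      using \<tau> d by (auto simp: mult_le_cancel_right1)
    have "ln (d / (\<tau> * d)) = ln ((2 * D)\<^sup>2)"
      using d by (simp add: \<tau>_def)
    also have "\<dots> = 2 * ln (2 * D)"
      using D by (subst ln_realpow) auto
    also have "\<dots> \<le> 2 * (2 * D)"
      using ln_le_minus_one[of "2 * D"] D by (intro mult_left_mono) auto
    finally have "\<tau> * d * (D + ln (d / (\<tau> * d))) \<le> \<tau> * d * (5 * D)"
      using t by (intro mult_left_mono) auto
    also have "\<dots> = \<tau> * (5 * D) * d"
      by simp
    also have "\<dots> < 1 * real d"
      using \<tau> d by (intro mult_strict_right_mono) auto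
    finally have "exp (\<tau> * d * (D + ln (d / (\<tau> * d)))) < exp (real d)"
      by simp
    also have "\<dots> = exp 1 ^ d"
      by (simp add: exp_of_nat_mult[symmetric])
    also have "\<dots> \<le> 3 ^ d"
      using exp_le by (intro power_mono) auto
    also have "\<dots> \<le> real n"
      using n by (metis of_nat_le_iff of_nat_power of_nat_numeral)
    finally have "card {k \<in> lattice d. sob_weight d R k \<le> 1 + \<tau> * d} < n"
      using count1[OF t] by linarith
    then have "approx_num d R n \<le> 1 / sqrt (\<tau> * d)"
      using R t by (intro approx_num_le_count) auto
    also have "\<dots> = 2 * D * real d powr (-1/2)"
      unfolding d_half using D by (simp add: \<tau>_def real_sqrt_mult real_sqrt_divide)
    \<comment> \<open>In this case \<open>n powr g\<close> is at most \<open>E powr u\<close>, so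
      the extra factor is at least 1.\<close>
    also have "\<dots> \<le> 2 * D * real d powr (-1/2) * (E powr u * real n powr (- g))"
    proof -
      have "sqrt (c * real n powr (2 * g)) \<le> sqrt 1"
        using False by (intro real_sqrt_le_mono) auto
      then have "E powr (- u) * real n powr g \<le> 1"
        by (simp only: real_sqrt_mult sqrt_c sqrt_n real_sqrt_one)
      then have "1 \<le> E powr u * real n powr (- g)"
        using E n0 by (simp add: powr_minus field_simps)
      then have "2 * D * real d powr (-1/2) * 1 \<le> 2 * D * real d powr (-1/2) * (E powr u * real n powr (- g))"
        using D by (intro mult_left_mono) auto
      then show ?thesis
        by simp
    qed
    finally show ?thesis
      by (simp add: E_def mult_ac)
  qed
qed

section \<open>Assembly of the constants\<close>

lemma choice2:
  assumes "\<And>x y. \<exists>a b. P x y a b"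
  shows "\<exists>f g. \<forall>x y. P x y (f x y) (g x y)"
  using assms by metis

text \<open>The middle range asks for \<open>2 \<le> n\<close> because \<open>log 2 1 = 0\<close>
  would stand in a denominator; \<open>n = 1\<close> lies in the first range, as
  \<open>d \<ge> 1\<close>.\<close>

theorem theorem2p1:
  shows "\<exists>c C :: real \<Rightarrow> real \<Rightarrow> real.
    \<forall>u v. 0 < v \<and> v \<le> u \<longrightarrow>
      0 < c u v \<and> c u v \<le> C u v \<and>
      (\<forall>(d::nat) (R::nat \<Rightarrow> real).
        d \<ge> 1 \<and> (\<forall>j<d. 0 < R j) \<and>
        u = Max (R ` {..<d}) \<and> v = Min (R ` {..<d}) \<longrightarrow>
        (let g = 1 / (\<Sum>j<d. 1 / R j) in
         \<forall>n::nat. n \<ge> 1 \<longrightarrow>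
           (n \<le> d \<longrightarrow>
              c u v \<le> approx_num d R n \<and> approx_num d R n \<le> C u v) \<and>
           (d \<le> n \<and> n \<le> 3 ^ d \<and> 2 \<le> n \<longrightarrow>
              (let \<phi> = sqrt (log 2 (1 + real d / log 2 (real n)) / log 2 (real n)) in
               c u v * \<phi> \<le> approx_num d R n \<and> approx_num d R n \<le> C u v * \<phi>)) \<and>
           (3 ^ d \<le> n \<longrightarrow>
              (let \<phi> = real d powr (-1/2) * real n powr (- g) in
               c u v * \<phi> \<le> approx_num d R n \<and> approx_num d R n \<le> C u v * \<phi>))))"
  (is "\<exists>c C. \<forall>u v. ?P u v (c u v) (C u v)")
proof -
  have "\<exists>c C. ?P u v c C" for u v :: real
  proof (cases "0 < v \<and> v \<le> u")
    case True
    obtain D :: real where D: "D \<ge> 9"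
      and count1: "\<And>d R t::real. \<lbrakk>\<And>j. j < d \<Longrightarrow> v \<le> R j; 0 < t; t \<le> real d\<rbrakk> \<Longrightarrow>
        real (card {k \<in> lattice d. sob_weight d R k \<le> 1 + t}) \<le> exp (t * (D + ln (d / t)))"
      and count2: "\<And>d R t::real. \<lbrakk>\<And>j. j < d \<Longrightarrow> v \<le> R j; 0 < t; real d \<le> t; 0 < d\<rbrakk> \<Longrightarrow>
        real (card {k \<in> lattice d. sob_weight d R k \<le> 1 + t})
          \<le> (exp 1 * D) ^ d * (t / d) powr (\<Sum>j<d. 1 / (2 * R j))"
      using card_sublevel_bounds[of v] True by blast
    define c :: real where "c = 1 / sqrt 5"
    define C where "C = 8 * D * (2 * exp 1 * D) powr u"
    have c: "0 < c" "c \<le> 1" "c \<le> 1 / sqrt 2"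
      by (auto simp: c_def intro!: divide_left_mono)
    have "1 * 1 \<le> 2 * exp 1 * D"
      using D one_le_exp_iff[of 1] by (intro mult_mono) linarith+
    then have E: "(2 * exp 1 * D) powr u \<ge> 1"
      using True by (intro ge_one_powr_ge_zero) auto
    have CD: "8 * D \<le> C"
      using D E by (simp add: C_def mult_le_cancel_left1)
    then have C: "1 \<le> C" "c \<le> C"
      using D c by linarith+
    have CE: "2 * D * (2 * exp 1 * D) powr u \<le> C"
      unfolding C_def using D by (intro mult_right_mono) auto
    have bounds: "(n \<le> d \<longrightarrow> c \<le> approx_num d R n \<and> approx_num d R n \<le> C) \<and>
           (d \<le> n \<and> n \<le> 3 ^ d \<and> 2 \<le> n \<longrightarrow>
              (let \<phi> = sqrt (log 2 (1 + real d / log 2 (real n)) / log 2 (real n)) in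
               c * \<phi> \<le> approx_num d R n \<and> approx_num d R n \<le> C * \<phi>)) \<and>
           (3 ^ d \<le> n \<longrightarrow>
              (let \<phi> = real d powr (-1/2) * real n powr (- (1 / (\<Sum>j<d. 1 / R j))) in
               c * \<phi> \<le> approx_num d R n \<and> approx_num d R n \<le> C * \<phi>))"
      if dR: "d \<ge> 1" "\<forall>j<d. 0 < R j" "u = Max (R ` {..<d})" "v = Min (R ` {..<d})" and n: "n \<ge> 1"
      for d R and n :: nat
    proof (intro conjI impI)
      have R: "v \<le> R j" "R j \<le> u" "0 < R j" if "j < d" for j
        using that dR by auto
      assume nd: "n \<le> d"
      \<comment> \<open>The case \<open>s = 1\<close>: the 2 d frequencies with a single entry 1 or
        -1 have weight 2.\<close>
      have "1 / sqrt (1 + real 1) \<le> approx_num d R n"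
        using n nd by (intro approx_num_ge_sparse) auto
      then show "c \<le> approx_num d R n"
        using c by simp
      \<comment> \<open>Truncation to the empty set is the zero operator, and every weight is at
        least 1.\<close>
      have "approx_num d R n \<le> 1 / sqrt 1"
        using n sob_weight_ge_1 by (intro approx_num_le[where F = "{}"]) auto
      then show "approx_num d R n \<le> C"
        using C by simp
    next
      have R: "v \<le> R j" "R j \<le> u" "0 < R j" if "j < d" for j
        using that dR by auto
      assume nd: "d \<le> n \<and> n \<le> 3 ^ d \<and> 2 \<le> n"
      let ?\<phi> = "sqrt (log 2 (1 + real d / log 2 (real n)) / log 2 (real n))"
      have "c * ?\<phi> \<le> approx_num d R n"
        unfolding c_def using R nd dR by (intro approx_num_lower_middle) auto
      moreover have "approx_num d R n \<le> 8 * D * ?\<phi>"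
        using R nd dR D count1 by (intro approx_num_upper_middle) auto
      moreover have "8 * D * ?\<phi> \<le> C * ?\<phi>"
      proof (rule mult_right_mono[OF CD])
        have "1 \<le> log 2 (real n)"
          using nd by (simp add: le_log_iff)
        then show "0 \<le> ?\<phi>"
          by (intro real_sqrt_ge_zero divide_nonneg_nonneg zero_le_log_cancel_iff[THEN iffD2])
             (use nd in \<open>auto intro: add_pos_nonneg\<close>)
      qed
      ultimately show "let \<phi> = ?\<phi> in c * \<phi> \<le> approx_num d R n \<and> approx_num d R n \<le> C * \<phi>"
        by (simp add: Let_def)
    next
      have R: "v \<le> R j" "R j \<le> u" "0 < R j" if "j < d" for j
        using that dR by auto
      assume nd: "3 ^ d \<le> n"
      let ?\<phi> = "real d powr (-1/2) * real n powr (- (1 / (\<Sum>j<d. 1 / R j)))"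
      have "c * ?\<phi> \<le> 1 / sqrt 2 * ?\<phi>"
        using c by (intro mult_right_mono) auto
      also have "\<dots> \<le> approx_num d R n"
        using R n dR by (intro approx_num_lower_large) auto
      finally have lower: "c * ?\<phi> \<le> approx_num d R n" .
      have "approx_num d R n \<le> 2 * D * (2 * exp 1 * D) powr u * ?\<phi>"
        using R nd dR D count1 count2 by (intro approx_num_upper_large) auto
      also have "\<dots> \<le> C * ?\<phi>"
        by (intro mult_right_mono CE) auto
      finally show "let \<phi> = ?\<phi> in c * \<phi> \<le> approx_num d R n \<and> approx_num d R n \<le> C * \<phi>"
        using lower by (simp add: Let_def)
    qed
    show ?thesis
      by (intro exI[of _ c] exI[of _ C] impI conjI[OF c(1)] conjI[OF C(2)] allI)
         (unfold Let_def, intro allI impI, rule bounds[unfolded Let_def], auto)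
  next
    case False
    show ?thesis
      by (intro exI impI, erule notE[OF False])
  qed
  then show ?thesis
    by (rule choice2[of ?P])
qed

end
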